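(* Every Oka-1 manifold is strongly Liouville.
   Context: A complex manifold $X$ is Liouville if it carries no nonconstant negative plurisubharmonic functions, and strongly Liouville if the universal covering space of $X$ is Liouville. Oka-1 manifold: a connected complex manifold $X$, with a distance function $\mathrm{dist}_X$ inducing its topology, is an Oka-1 manifold if for any open (i.e. connected, noncompact) Riemann surface $R$, compact Runge set $K\subset R$ (i.e. $R\setminus K$ has no relatively compact connected components), discrete sequence $a_i\in R$ without repetitions, continuous map $f:R\to X$ holomorphic on a neighbourhood of $K\cup\bigcup_i\{a_i\}$, number $\epsilon>0$ and integers $k_i\in\mathbb{N}=\{1,2,\ldots\}$ there is a holomorphic map $F:R\to X$ homotopic to $f$ such that (1) $\sup_{p\in K}\mathrm{dist}_X(F(p),f(p))<\epsilon$, and (2) $F$ agrees with $f$ to order $k_i$ at $a_i$ for every $i$. (Manifolds are considered connected here.) *)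

theory Defs
  imports "HOL-Analysis.Analysis" "HOL-Library.Landau_Symbols"
begin

section \<open>Complex manifolds and holomorphic maps\<close>

definition holo_vec_on :: "(complex ^ 'n) set \<Rightarrow> (complex ^ 'n \<Rightarrow> complex ^ 'm) \<Rightarrow> bool" where
  "holo_vec_on S f \<longleftrightarrow>
     (\<forall>z\<in>S. \<exists>D. (f has_derivative D) (at z) \<and> (\<forall>c v. D (c *s v) = c *s D v))"

text \<open>The points of a manifold are those of \<^term>\<open>topspace (mtop M)\<close>, a subset of the type
  \<open>'a\<close>. A chart is a pair \<open>(U, \<phi>)\<close> of a domain and a coordinate map; the values of \<open>\<phi>\<close> off \<open>U\<close>
  carry no meaning, and the inverse chart is \<open>inv_into U \<phi>\<close>. The complex dimension is
  \<open>CARD('n)\<close>, so that it is at least 1. The atlas need not be maximal.\<close>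

record ('a, 'n) mfd =
  mtop :: "'a topology"
  charts :: "('a set \<times> ('a \<Rightarrow> complex ^ 'n)) set"

definition complex_manifold :: "('a, 'n::finite) mfd \<Rightarrow> bool" where
  "complex_manifold M \<longleftrightarrow>
     topspace (mtop M) \<noteq> {} \<and> connected_space (mtop M) \<and>
     Hausdorff_space (mtop M) \<and> second_countable (mtop M) \<and>
     \<Union> (fst ` charts M) = topspace (mtop M) \<and>
     (\<forall>(U, \<phi>) \<in> charts M. openin (mtop M) U \<and> open (\<phi> ` U) \<and>
        homeomorphic_map (subtopology (mtop M) U) (top_of_set (\<phi> ` U)) \<phi>) \<and>
     (\<forall>(U, \<phi>) \<in> charts M. \<forall>(V, \<psi>) \<in> charts M.
        holo_vec_on (\<phi> ` (U \<inter> V)) (\<psi> \<circ> inv_into U \<phi>))"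

definition holo_map_on ::
    "('a, 'n::finite) mfd \<Rightarrow> ('b, 'm::finite) mfd \<Rightarrow> 'a set \<Rightarrow> ('a \<Rightarrow> 'b) \<Rightarrow> bool" where
  "holo_map_on M N W f \<longleftrightarrow>
     openin (mtop M) W \<and> continuous_map (subtopology (mtop M) W) (mtop N) f \<and>
     (\<forall>(U, \<phi>) \<in> charts M. \<forall>(V, \<psi>) \<in> charts N.
        holo_vec_on (\<phi> ` (U \<inter> W \<inter> f -` V)) (\<psi> \<circ> f \<circ> inv_into U \<phi>))"

abbreviation holo_map :: "('a, 'n::finite) mfd \<Rightarrow> ('b, 'm::finite) mfd \<Rightarrow> ('a \<Rightarrow> 'b) \<Rightarrow> bool" where
  "holo_map M N f \<equiv> holo_map_on M N (topspace (mtop M)) f"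

text \<open>Equality of \<open>k\<close>-jets at \<open>a\<close>: in local coordinates the Taylor polynomials of degree \<open>k\<close>
  coincide.\<close>

definition agree_to_order ::
    "('a, 'n::finite) mfd \<Rightarrow> ('b, 'm::finite) mfd \<Rightarrow> nat \<Rightarrow> 'a \<Rightarrow> ('a \<Rightarrow> 'b) \<Rightarrow> ('a \<Rightarrow> 'b) \<Rightarrow> bool" where
  "agree_to_order M N k a f g \<longleftrightarrow>
     f a = g a \<and>
     (\<forall>(U, \<phi>) \<in> charts M. \<forall>(V, \<psi>) \<in> charts N. a \<in> U \<longrightarrow> f a \<in> V \<longrightarrow>
        (\<lambda>z. norm (\<psi> (f (inv_into U \<phi> z)) - \<psi> (g (inv_into U \<phi> z))))
          \<in> o[at (\<phi> a)](\<lambda>z. norm (z - \<phi> a) ^ k))"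


section \<open>Plurisubharmonic functions and Liouville manifolds\<close>

text \<open>The extended Lebesgue integral of a function with values in \<open>[-\<infinity>,\<infinity>]\<close>, as the difference of
  the integrals of the positive and the negative part (\<^const>\<open>e2ennreal\<close> maps negative numbers
  to 0). Below, the integrand is bounded above, so that \<open>\<infinity> - \<infinity>\<close> does not occur.\<close>

definition circle_mean :: "(complex \<Rightarrow> ereal) \<Rightarrow> complex \<Rightarrow> real \<Rightarrow> ereal" where
  "circle_mean v z r =
     ereal (1 / (2 * pi)) *
      (enn2ereal (\<integral>\<^sup>+ t \<in> {0..2 * pi}. e2ennreal (v (z + of_real r * cis t)) \<partial>lborel) -
       enn2ereal (\<integral>\<^sup>+ t \<in> {0..2 * pi}. e2ennreal (- v (z + of_real r * cis t)) \<partial>lborel))"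

text \<open>Upper semicontinuity is stated for open \<open>S\<close>. The constant \<open>-\<infinity>\<close> counts as subharmonic and
  plurisubharmonic.\<close>

definition usc_on :: "'a::topological_space set \<Rightarrow> ('a \<Rightarrow> ereal) \<Rightarrow> bool" where
  "usc_on S u \<longleftrightarrow> (\<forall>z\<in>S. u z < \<infinity>) \<and> (\<forall>c. open {z \<in> S. u z < c})"

definition subharmonic_on :: "complex set \<Rightarrow> (complex \<Rightarrow> ereal) \<Rightarrow> bool" where
  "subharmonic_on S v \<longleftrightarrow>
     usc_on S v \<and> (\<forall>z r. 0 < r \<longrightarrow> cball z r \<subseteq> S \<longrightarrow> v z \<le> circle_mean v z r)"

definition psh_vec_on :: "(complex ^ 'n) set \<Rightarrow> (complex ^ 'n \<Rightarrow> ereal) \<Rightarrow> bool" where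
  "psh_vec_on S u \<longleftrightarrow>
     usc_on S u \<and>
     (\<forall>z w. subharmonic_on {\<zeta>. z + \<zeta> *s w \<in> S} (\<lambda>\<zeta>. u (z + \<zeta> *s w)))"

definition plurisubharmonic :: "('a, 'n::finite) mfd \<Rightarrow> ('a \<Rightarrow> ereal) \<Rightarrow> bool" where
  "plurisubharmonic M u \<longleftrightarrow> (\<forall>(U, \<phi>) \<in> charts M. psh_vec_on (\<phi> ` U) (u \<circ> inv_into U \<phi>))"

definition liouville :: "('a, 'n::finite) mfd \<Rightarrow> bool" where
  "liouville M \<longleftrightarrow>
     (\<forall>u. plurisubharmonic M u \<and> (\<forall>x \<in> topspace (mtop M). u x < 0) \<longrightarrow>
        (\<exists>c. \<forall>x \<in> topspace (mtop M). u x = c))"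


section \<open>Universal coverings\<close>

text \<open>The analogue of \<^const>\<open>simply_connected\<close> for abstract topologies: any two loops are freely
  homotopic through loops. In particular the space is path connected.\<close>

definition simply_connected_space :: "'a topology \<Rightarrow> bool" where
  "simply_connected_space X \<longleftrightarrow>
     (\<forall>p q. pathin X p \<and> p 1 = p 0 \<and> pathin X q \<and> q 1 = q 0 \<longrightarrow>
        homotopic_with (\<lambda>r. r 1 = r 0) (top_of_set {0..1}) X p q)"

definition biholo_on ::
    "('a, 'n::finite) mfd \<Rightarrow> ('b, 'n) mfd \<Rightarrow> 'a set \<Rightarrow> 'b set \<Rightarrow> ('a \<Rightarrow> 'b) \<Rightarrow> bool" where
  "biholo_on M N U V f \<longleftrightarrow>
     bij_betw f U V \<and> holo_map_on M N U f \<and> holo_map_on N M V (inv_into U f)"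

text \<open>A covering whose total space carries the complex structure lifted from the base: the sheets
  over an evenly covered open set are mapped biholomorphically onto it.\<close>

definition holo_covering :: "('b, 'n::finite) mfd \<Rightarrow> ('b \<Rightarrow> 'a) \<Rightarrow> ('a, 'n) mfd \<Rightarrow> bool" where
  "holo_covering Y p X \<longleftrightarrow>
     holo_map Y X p \<and> p ` topspace (mtop Y) = topspace (mtop X) \<and>
     (\<forall>x \<in> topspace (mtop X). \<exists>V. x \<in> V \<and> openin (mtop X) V \<and>
        (\<exists>\<U>. \<Union>\<U> = topspace (mtop Y) \<inter> p -` V \<and> pairwise disjnt \<U> \<and>
             (\<forall>U\<in>\<U>. openin (mtop Y) U \<and> biholo_on Y X U V p)))"

definition universal_covering :: "('b, 'n::finite) mfd \<Rightarrow> ('b \<Rightarrow> 'a) \<Rightarrow> ('a, 'n) mfd \<Rightarrow> bool" where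
  "universal_covering Y p X \<longleftrightarrow>
     complex_manifold Y \<and> simply_connected_space (mtop Y) \<and> holo_covering Y p X"

text \<open>The universal covering space is unique up to biholomorphism, so the definition quantifies over
  all its realisations with points in the type \<open>'b\<close>. The type argument is needed because a
  definition cannot quantify over types; the space of homotopy classes of paths
  is a realisation for \<open>'b = (real \<Rightarrow> 'a) set\<close>.\<close>

definition strongly_liouville :: "'b itself \<Rightarrow> ('a, 'n::finite) mfd \<Rightarrow> bool" where
  "strongly_liouville (_ :: 'b itself) X \<longleftrightarrow>
     (\<forall>(Y :: ('b, 'n) mfd) p. universal_covering Y p X \<longrightarrow> liouville Y)"


section \<open>Oka-1 manifolds\<close>

definition open_riemann_surface :: "('a, 1) mfd \<Rightarrow> bool" where
  "open_riemann_surface R \<longleftrightarrow> complex_manifold R \<and> \<not> compact_space (mtop R)"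

definition compact_runge :: "'a topology \<Rightarrow> 'a set \<Rightarrow> bool" where
  "compact_runge T K \<longleftrightarrow>
     compactin T K \<and>
     (\<forall>C \<in> connected_components_of (subtopology T (topspace T - K)).
        \<not> compactin T (T closure_of C))"

text \<open>Discrete sequences are those without accumulation point in the ambient space.\<close>

definition discrete_sequence :: "'a topology \<Rightarrow> (nat \<Rightarrow> 'a) \<Rightarrow> bool" where
  "discrete_sequence T a \<longleftrightarrow>
     range a \<subseteq> topspace T \<and> inj a \<and> T derived_set_of (range a) = {}"

text \<open>A connected Riemann surface has the cardinality of the continuum, so it is no restriction that
  the points of \<open>R\<close> below are taken from the type \<open>complex\<close>: the topology and the charts of
  \<open>R\<close> are arbitrary and unrelated to the standard ones. The supremum over \<open>K\<close> is taken in the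
  extended reals in order to be correct for \<open>K = {}\<close>, too.\<close>

definition oka1_manifold :: "('a, 'n::finite) mfd \<Rightarrow> ('a \<Rightarrow> 'a \<Rightarrow> real) \<Rightarrow> bool" where
  "oka1_manifold X d \<longleftrightarrow>
     complex_manifold X \<and>
     Metric_space (topspace (mtop X)) d \<and>
     Metric_space.mtopology (topspace (mtop X)) d = mtop X \<and>
     (\<forall>(R :: (complex, 1) mfd) K a f W \<epsilon> k.
        open_riemann_surface R \<longrightarrow>
        compact_runge (mtop R) K \<longrightarrow>
        discrete_sequence (mtop R) a \<longrightarrow>
        continuous_map (mtop R) (mtop X) f \<longrightarrow>
        openin (mtop R) W \<longrightarrow> K \<union> range a \<subseteq> W \<longrightarrow> holo_map_on R X W f \<longrightarrow>
        (0::real) < \<epsilon> \<longrightarrow>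
        (\<forall>i::nat. (1::nat) \<le> k i) \<longrightarrow>
        (\<exists>F. holo_map R X F \<and>
             homotopic_with (\<lambda>_. True) (mtop R) (mtop X) f F \<and>
             (SUP p\<in>K. ereal (d (F p) (f p))) < ereal \<epsilon> \<and>
             (\<forall>i. agree_to_order R X (k i) (a i) F f)))"

end

theory Submission
  imports Defs "HOL-Complex_Analysis.Cauchy_Integral_Formula"
begin

text \<open>
  Let \<open>p: Y \<rightarrow> X\<close> be the universal covering of an Oka-1 manifold and \<open>u < 0\<close>
  plurisubharmonic on \<open>Y\<close>. If \<open>h: \<complex> \<rightarrow> Y\<close> is an entire curve, then
  \<open>u \<circ> h\<close> is a negative subharmonic function on the plane, hence constant; so \<open>u\<close>
  takes the same value at any two points that are joined by an entire curve. As \<open>Y\<close> is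
  connected, it is enough to join every point \<open>y0\<close> to all points \<open>y1\<close> near it.

  To do so, take an evenly covered neighbourhood \<open>V\<close> of \<open>p y0\<close> and an affine disc in
  a small coordinate ball through \<open>p y0\<close> and \<open>p y1\<close>, extended continuously to the
  plane. The Oka-1 property replaces it by an entire curve \<open>F\<close> in \<open>X\<close> through the same
  two points that maps the closed unit disc into \<open>V\<close>
  (\<open>oka1_entire_curve_through_two_points\<close>). Since the plane is simply connected, \<open>F\<close>
  lifts to an entire curve \<open>h\<close> in \<open>Y\<close> that starts at \<open>y0\<close>
  (\<open>lift_exists_plane\<close>, \<open>entire_curve_lift\<close>). The unit disc is connected and is mapped
  into \<open>V\<close>, so its lift stays in the sheet of \<open>y0\<close>, and therefore \<open>h\<close> meets
  \<open>y1\<close> and not another point over \<open>p y1\<close>.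

  The analytic part is that \<open>u \<circ> h\<close> is constant. Subharmonicity of \<open>u \<circ> h\<close> is
  needed only as a comparison with smooth strictly superharmonic functions
  (\<open>viscosity_subharmonic\<close>). In this form it follows from the sub-mean value property of
  \<open>u\<close> on complex lines by doubling the variables (\<open>psh_no_strict_contact\<close>), without
  regularisation of \<open>u\<close>. Comparison with \<open>\<epsilon> ln |z - a|\<close> on large annuli around
  \<open>a\<close> then bounds \<open>u \<circ> h\<close> by its value at \<open>a\<close>, for every \<open>a\<close>
  (\<open>viscosity_subharmonic_negative_imp_le\<close>).
\<close>

section \<open>Lifting maps of the plane through a covering\<close>

definition sheet :: "'b topology \<Rightarrow> 'a topology \<Rightarrow> ('b \<Rightarrow> 'a) \<Rightarrow> 'b set \<Rightarrow> 'a set \<Rightarrow> bool" where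
  "sheet Y X p U V \<longleftrightarrow>
     openin Y U \<and> openin X V \<and> bij_betw p U V \<and> continuous_map (subtopology X V) Y (inv_into U p)"

text \<open>Evenly covered sets are described by the sheet through each point over them, the form in which
  a lift is continued.\<close>

definition topological_covering :: "'b topology \<Rightarrow> 'a topology \<Rightarrow> ('b \<Rightarrow> 'a) \<Rightarrow> bool" where
  "topological_covering Y X p \<longleftrightarrow>
     continuous_map Y X p \<and>
     (\<forall>x\<in>topspace X. \<exists>V. x \<in> V \<and> openin X V \<and>
        (\<forall>y\<in>topspace Y. p y \<in> V \<longrightarrow> (\<exists>U. y \<in> U \<and> sheet Y X p U V)))"

lemma topological_coveringE:
  assumes "topological_covering Y X p" "x \<in> topspace X"
  obtains V where "x \<in> V" "openin X V"
    "\<And>y. y \<in> topspace Y \<Longrightarrow> p y \<in> V \<Longrightarrow> \<exists>U. y \<in> U \<and> sheet Y X p U V"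
  using assms unfolding topological_covering_def by meson

text \<open>The set where two lifts agree is closed because the covering space is Hausdorff, and open because
  the projection is injective on the sheet through a common value.\<close>

lemma lift_unique:
  assumes Y: "Hausdorff_space Y" and cov: "topological_covering Y X p"
    and Z: "connected_space Z"
    and g: "continuous_map Z Y g" and h: "continuous_map Z Y h"
    and eq: "\<And>z. z \<in> topspace Z \<Longrightarrow> p (g z) = p (h z)"
    and z0: "z0 \<in> topspace Z" "g z0 = h z0"
    and z: "z \<in> topspace Z"
  shows "g z = h z"
proof -
  let ?T = "{z \<in> topspace Z. g z = h z}"
  have "\<exists>N. openin Z N \<and> z \<in> N \<and> N \<subseteq> ?T" if "z \<in> ?T" for z
  proof -
    have gz: "g z \<in> topspace Y"
      using that g continuous_map_image_subset_topspace by fastforce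
    then have "p (g z) \<in> topspace X"
      using cov by (auto simp: topological_covering_def continuous_map_def)
    then obtain U V where U: "g z \<in> U" "sheet Y X p U V"
      using topological_coveringE[OF cov] gz by metis
    define N where "N = {z \<in> topspace Z. g z \<in> U} \<inter> {z \<in> topspace Z. h z \<in> U}"
    have "openin Z N"
      unfolding N_def using U g h by (auto simp: sheet_def intro: openin_continuous_map_preimage)
    moreover have "z \<in> N" using U that by (auto simp: N_def)
    moreover have "N \<subseteq> ?T"
      using U eq by (auto simp: N_def sheet_def bij_betw_def dest: inj_onD)
    ultimately show ?thesis by blast
  qed
  then have "openin Z ?T" by (subst openin_subopen) blast
  moreover have "closedin Z ?T" by (rule closedin_continuous_maps_eq[OF Y g h])
  ultimately have "?T = topspace Z" using Z z0 unfolding connected_space_clopen_in by blast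
  then show ?thesis using z by blast
qed

lemma lift_into_sheet:
  assumes U: "sheet Y X p U V" and F: "continuous_map Z X F" and V: "F ` topspace Z \<subseteq> V"
  shows "continuous_map Z Y (inv_into U p \<circ> F)"
    and "\<And>z. z \<in> topspace Z \<Longrightarrow> p (inv_into U p (F z)) = F z"
proof -
  have "continuous_map Z (subtopology X V) F"
    using F V by (auto simp: continuous_map_in_subtopology)
  then show "continuous_map Z Y (inv_into U p \<circ> F)"
    using U continuous_map_compose unfolding sheet_def by blast
  show "p (inv_into U p (F z)) = F z" if "z \<in> topspace Z" for z
    using that V U by (auto simp: sheet_def bij_betw_def intro!: f_inv_into_f)
qed

text \<open>The base point and the point over it are arbitrary, so that a lift on one piece can be continued
  to an adjacent piece with the value already reached on the common edge.\<close>

definition has_lifts :: "'b topology \<Rightarrow> ('b \<Rightarrow> 'a) \<Rightarrow> (complex \<Rightarrow> 'a) \<Rightarrow> complex set \<Rightarrow> bool" where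
  "has_lifts Y p F S \<longleftrightarrow>
     (\<forall>z0\<in>S. \<forall>y0\<in>topspace Y. p y0 = F z0 \<longrightarrow>
        (\<exists>h. continuous_map (top_of_set S) Y h \<and> (\<forall>z\<in>S. p (h z) = F z) \<and> h z0 = y0))"

text \<open>The overlap is connected, so two lifts that agree at one of its points agree on all of it and can be
  pasted together.\<close>

lemma has_lifts_Un:
  assumes Y: "Hausdorff_space Y" and cov: "topological_covering Y X p"
    and AB: "closed A" "closed B" "connected (A \<inter> B)" "A \<inter> B \<noteq> {}"
    and liftA: "has_lifts Y p F A" and liftB: "has_lifts Y p F B"
  shows "has_lifts Y p F (A \<union> B)"
proof -
  have glue: "\<exists>h. continuous_map (top_of_set (A \<union> B)) Y h \<and> (\<forall>z\<in>A \<union> B. p (h z) = F z) \<and> h z0 = y0"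
    if AB: "closed A" "closed B" "connected (A \<inter> B)" "A \<inter> B \<noteq> {}"
      and liftA: "has_lifts Y p F A" and liftB: "has_lifts Y p F B"
      and z0: "z0 \<in> A" and y0: "y0 \<in> topspace Y" "p y0 = F z0" for A B z0 y0
  proof -
    obtain h where h: "continuous_map (top_of_set A) Y h" "\<forall>z\<in>A. p (h z) = F z" "h z0 = y0"
      using liftA z0 y0 unfolding has_lifts_def by blast
    obtain e where e: "e \<in> A" "e \<in> B" using AB by blast
    have "h e \<in> topspace Y" using h(1) e by (auto simp: continuous_map_def)
    then obtain k where k: "continuous_map (top_of_set B) Y k" "\<forall>z\<in>B. p (k z) = F z" "k e = h e"
      using liftB e h(2) unfolding has_lifts_def by metis
    have hk: "h z = k z" if "z \<in> A \<inter> B" for z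
    proof (rule lift_unique[OF Y cov, where Z = "top_of_set (A \<inter> B)" and ?z0.0 = e])
      show "connected_space (top_of_set (A \<inter> B))"
        using AB(3) by (metis connectedin_def connectedin_iff_connected)
      show "continuous_map (top_of_set (A \<inter> B)) Y h" "continuous_map (top_of_set (A \<inter> B)) Y k"
        using h(1) k(1) continuous_map_from_subtopology_mono by blast+
    qed (use that e h k in auto)
    define f where "f z = (if z \<in> A then h z else k z)" for z
    have "continuous_map (top_of_set (A \<union> B)) Y f"
    proof (rule pasting_lemma_closed[where I = "{True, False}" and T = "\<lambda>i. if i then A else B"
          and f = "\<lambda>i. if i then h else k"])
      show "closedin (top_of_set (A \<union> B)) (if i then A else B)" for i
        using AB(1,2) by (auto intro: closed_subset)
      show "continuous_map (subtopology (top_of_set (A \<union> B)) (if i then A else B)) Y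
              (if i then h else k)" for i
        using h(1) k(1) by (auto simp: subtopology_subtopology Int_absorb1)
    qed (use hk in \<open>auto simp: f_def split: if_splits\<close>)
    then show ?thesis
      using h k z0 by (intro exI[of _ f]) (auto simp: f_def)
  qed
  show ?thesis
    unfolding has_lifts_def
    using glue[of A B] glue[of B A] AB liftA liftB by (auto simp: Int_commute Un_commute)
qed

lemma has_lifts_evenly_covered:
  assumes F: "continuous_map (top_of_set S) X F" and V: "F ` S \<subseteq> V"
    and ev: "\<And>y. y \<in> topspace Y \<Longrightarrow> p y \<in> V \<Longrightarrow> \<exists>U. y \<in> U \<and> sheet Y X p U V"
  shows "has_lifts Y p F S"
  unfolding has_lifts_def
proof (intro ballI impI)
  fix z0 y0 assume z0: "z0 \<in> S" and y0: "y0 \<in> topspace Y" "p y0 = F z0"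
  then obtain U where U: "y0 \<in> U" "sheet Y X p U V" using ev V by (metis image_subset_iff)
  have "inv_into U p (F z0) = y0"
    using U y0 by (metis bij_betw_inv_into_left sheet_def)
  then show "\<exists>h. continuous_map (top_of_set S) Y h \<and> (\<forall>z\<in>S. p (h z) = F z) \<and> h z0 = y0"
    using lift_into_sheet[OF U(2) F] V by (intro exI[of _ "inv_into U p \<circ> F"]) auto
qed

text \<open>Lifts exist on rectangles inside a small disc, whose image is evenly covered, and rectangles can be
  glued along a common edge. Two rounds of the bisection principle \<open>Bolzano\<close> remove the
  smallness: first in the vertical direction, which gives narrow strips of any height, then in the
  horizontal direction.\<close>

lemma has_lifts_cbox:
  assumes Y: "Hausdorff_space Y" and cov: "topological_covering Y X p"
    and F: "continuous_map euclidean X F"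
  shows "has_lifts Y p F (cbox (Complex a c) (Complex b d))"
proof (cases "a \<le> b \<and> c \<le> d")
  case False
  then have "cbox (Complex a c) (Complex b d) = {}"
    by (auto simp: in_cbox_complex_iff)
  then show ?thesis by (simp add: has_lifts_def)
next
  case True
  define P where "P a b c d = has_lifts Y p F (cbox (Complex a c) (Complex b d))" for a b c d
  have horizontal: "P a e c d" if "P a b c d" "P b e c d" "a \<le> b" "b \<le> e" "c \<le> d" for a b c d e
  proof -
    have eq: "cbox (Complex a c) (Complex e d)
            = cbox (Complex a c) (Complex b d) \<union> cbox (Complex b c) (Complex e d)"
      and int: "cbox (Complex a c) (Complex b d) \<inter> cbox (Complex b c) (Complex e d)
            = cbox (Complex b c) (Complex b d)"
      using that by (auto simp: in_cbox_complex_iff)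
    have "Complex b c \<in> cbox (Complex b c) (Complex b d)"
      using that by (auto simp: in_cbox_complex_iff)
    then show ?thesis
      using that(1,2) unfolding P_def eq
      by (intro has_lifts_Un[OF Y cov]) (auto simp: int closed_cbox convex_connected)
  qed
  have vertical: "P a b c e" if "P a b c d" "P a b d e" "c \<le> d" "d \<le> e" "a \<le> b" for a b c d e
  proof -
    have eq: "cbox (Complex a c) (Complex b e)
            = cbox (Complex a c) (Complex b d) \<union> cbox (Complex a d) (Complex b e)"
      and int: "cbox (Complex a c) (Complex b d) \<inter> cbox (Complex a d) (Complex b e)
            = cbox (Complex a d) (Complex b d)"
      using that by (auto simp: in_cbox_complex_iff)
    have "Complex a d \<in> cbox (Complex a d) (Complex b d)"
      using that by (auto simp: in_cbox_complex_iff)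
    then show ?thesis
      using that(1,2) unfolding P_def eq
      by (intro has_lifts_Un[OF Y cov]) (auto simp: int closed_cbox convex_connected)
  qed
  have strip: "\<exists>\<delta>>0. \<forall>a b. a \<le> x \<and> x \<le> b \<and> b - a < \<delta> \<longrightarrow> P a b c d" for x
  proof (rule Bolzano[of c d "\<lambda>c d. \<exists>\<delta>>0. \<forall>a b. a \<le> x \<and> x \<le> b \<and> b - a < \<delta> \<longrightarrow> P a b c d"])
    fix c d e :: real
    assume "\<exists>\<delta>>0. \<forall>a b. a \<le> x \<and> x \<le> b \<and> b - a < \<delta> \<longrightarrow> P a b c d"
      and "\<exists>\<delta>>0. \<forall>a b. a \<le> x \<and> x \<le> b \<and> b - a < \<delta> \<longrightarrow> P a b d e"
      and le: "c \<le> d" "d \<le> e"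
    then obtain \<delta>1 \<delta>2 where \<delta>: "\<delta>1 > 0" "\<delta>2 > 0"
      "\<And>a b. a \<le> x \<Longrightarrow> x \<le> b \<Longrightarrow> b - a < \<delta>1 \<Longrightarrow> P a b c d"
      "\<And>a b. a \<le> x \<Longrightarrow> x \<le> b \<Longrightarrow> b - a < \<delta>2 \<Longrightarrow> P a b d e"
      by metis
    then have "P a b c e" if "a \<le> x" "x \<le> b" "b - a < min \<delta>1 \<delta>2" for a b
      using vertical[of a b c d e] that le by auto
    then show "\<exists>\<delta>>0. \<forall>a b. a \<le> x \<and> x \<le> b \<and> b - a < \<delta> \<longrightarrow> P a b c e"
      using \<delta>(1,2) by (intro exI[of _ "min \<delta>1 \<delta>2"]) auto
  next
    fix y
    have "F (Complex x y) \<in> topspace X"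
      using F continuous_map_image_subset_topspace by fastforce
    then obtain V where V: "F (Complex x y) \<in> V" "openin X V"
      "\<And>y. y \<in> topspace Y \<Longrightarrow> p y \<in> V \<Longrightarrow> \<exists>U. y \<in> U \<and> sheet Y X p U V"
      using topological_coveringE[OF cov] by metis
    have "open (F -` V)"
      using openin_continuous_map_preimage[OF F V(2)] by (simp add: vimage_def)
    then obtain \<delta> where \<delta>: "\<delta> > 0" "ball (Complex x y) \<delta> \<subseteq> F -` V"
      using V(1) by (metis open_contains_ball vimageI)
    have "P a b c d" if "a \<le> x" "x \<le> b" "b - a < \<delta>/2" "c \<le> y" "y \<le> d" "d - c < \<delta>/2" for a b c d
      unfolding P_def
    proof (rule has_lifts_evenly_covered[OF _ _ V(3)])
      show "continuous_map (top_of_set (cbox (Complex a c) (Complex b d))) X F"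
        using F continuous_map_from_subtopology by blast
      have "cbox (Complex a c) (Complex b d) \<subseteq> ball (Complex x y) \<delta>"
      proof
        fix z assume "z \<in> cbox (Complex a c) (Complex b d)"
        then have "a \<le> Re z" "Re z \<le> b" "c \<le> Im z" "Im z \<le> d"
          by (simp_all add: in_cbox_complex_iff)
        then have "\<bar>x - Re z\<bar> < \<delta>/2" "\<bar>y - Im z\<bar> < \<delta>/2"
          using that by linarith+
        then have "norm (Complex x y - z) < \<delta>"
          using cmod_le[of "Complex x y - z"] by simp
        then show "z \<in> ball (Complex x y) \<delta>" by (simp add: dist_norm)
      qed
      then show "F ` cbox (Complex a c) (Complex b d) \<subseteq> V" using \<delta> by blast
    qed
    then show "\<exists>e>0. \<forall>c d. c \<le> y \<and> y \<le> d \<and> d - c < e \<longrightarrow>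
                 (\<exists>\<delta>>0. \<forall>a b. a \<le> x \<and> x \<le> b \<and> b - a < \<delta> \<longrightarrow> P a b c d)"
      using \<delta>(1) by (meson half_gt_zero)
  qed (use True in auto)
  have "P a b c d"
  proof (rule Bolzano[of a b "\<lambda>a b. P a b c d"])
    show "P a e c d" if "P a b c d" "P b e c d" "a \<le> b" "b \<le> e" for a b e
      using horizontal that True by blast
  qed (use True strip in auto)
  then show ?thesis by (simp add: P_def)
qed

text \<open>The lifts on growing squares that start at the same point extend each other by uniqueness.\<close>

lemma lift_exists_plane:
  fixes F :: "complex \<Rightarrow> 'a"
  assumes Y: "Hausdorff_space Y" and cov: "topological_covering Y X p"
    and F: "continuous_map euclidean X F" and y0: "y0 \<in> topspace Y" "p y0 = F 0"
  obtains h where "continuous_map euclidean Y h" "\<And>z. p (h z) = F z" "h 0 = y0"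
proof -
  define B where "B n = cbox (Complex (- real n) (- real n)) (Complex (real n) (real n))" for n
  have B0: "0 \<in> B n" for n by (auto simp: B_def in_cbox_complex_iff)
  have "\<exists>h. continuous_map (top_of_set (B n)) Y h \<and> (\<forall>z\<in>B n. p (h z) = F z) \<and> h 0 = y0" for n
    using has_lifts_cbox[OF Y cov F] y0 B0 unfolding has_lifts_def B_def by blast
  then obtain h where h: "\<And>n. continuous_map (top_of_set (B n)) Y (h n)"
      "\<And>n z. z \<in> B n \<Longrightarrow> p (h n z) = F z" "\<And>n. h n 0 = y0"
    by metis
  have coherent: "h m z = h n z" if "z \<in> B m" "z \<in> B n" for m n z
  proof (rule lift_unique[OF Y cov, where Z = "top_of_set (B m \<inter> B n)" and ?z0.0 = 0])
    have "connected (B m \<inter> B n)"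
      unfolding B_def by (intro convex_connected convex_Int convex_box)
    then show "connected_space (top_of_set (B m \<inter> B n))"
      by (metis connectedin_def connectedin_iff_connected)
    show "continuous_map (top_of_set (B m \<inter> B n)) Y (h m)"
      "continuous_map (top_of_set (B m \<inter> B n)) Y (h n)"
      using h(1) continuous_map_from_subtopology_mono by blast+
  qed (use that h B0 in auto)
  have ball_B: "ball 0 (real n) \<subseteq> B n" for n
  proof
    fix z :: complex assume "z \<in> ball 0 (real n)"
    then have "norm z < real n" by simp
    then have "\<bar>Re z\<bar> < real n" "\<bar>Im z\<bar> < real n"
      using abs_Re_le_cmod[of z] abs_Im_le_cmod[of z] by linarith+
    then show "z \<in> B n" by (auto simp: B_def in_cbox_complex_iff)
  qed
  define N where "N z = Suc (nat \<lfloor>norm z\<rfloor>)" for z :: complex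
  have N: "z \<in> ball 0 (real (N z))" for z
    unfolding N_def mem_ball_0 using norm_ge_zero[of z] by linarith
  have "continuous_map euclidean Y (\<lambda>z. h (N z) z)"
  proof (rule pasting_lemma[where I = UNIV and T = "\<lambda>n. ball 0 (real n)" and f = h])
    show "continuous_map (top_of_set (ball 0 (real n))) Y (h n)" for n
      using h(1) ball_B continuous_map_from_subtopology_mono by blast
    show "h m z = h n z"
      if "z \<in> topspace euclidean \<inter> ball 0 (real m) \<inter> ball 0 (real n)" for m n z
      using coherent that ball_B by blast
    show "\<exists>n. n \<in> UNIV \<and> z \<in> ball 0 (real n) \<and> h (N z) z = h n z" for z
      using N by blast
  qed auto
  moreover have "p (h (N z) z) = F z" for z using h(2) N ball_B by blast
  ultimately show ?thesis using that h(3) by blast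
qed

section \<open>Circle means\<close>

lemma circle_mean_mono:
  assumes "\<And>\<zeta>. \<zeta> \<in> sphere z r \<Longrightarrow> v \<zeta> \<le> w \<zeta>" and "0 \<le> r"
  shows "circle_mean v z r \<le> circle_mean w z r"
proof -
  have le: "v (z + of_real r * cis t) \<le> w (z + of_real r * cis t)" for t
    using assms by (auto simp: dist_norm norm_mult)
  have mono: "(\<integral>\<^sup>+ t \<in> {0..2 * pi}. e2ennreal (f t) \<partial>lborel) \<le> (\<integral>\<^sup>+ t \<in> {0..2 * pi}. e2ennreal (g t) \<partial>lborel)"
    if "\<And>t. f t \<le> g t" for f g :: "real \<Rightarrow> ereal"
    using that by (intro nn_integral_mono mult_right_mono e2ennreal_mono) auto
  show ?thesis
    unfolding circle_mean_def
  proof (intro ereal_mult_left_mono ereal_minus_mono)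
    show "enn2ereal (\<integral>\<^sup>+ t \<in> {0..2 * pi}. e2ennreal (v (z + of_real r * cis t)) \<partial>lborel)
       \<le> enn2ereal (\<integral>\<^sup>+ t \<in> {0..2 * pi}. e2ennreal (w (z + of_real r * cis t)) \<partial>lborel)"
      unfolding less_eq_ennreal.rep_eq[symmetric] by (intro mono le)
    show "enn2ereal (\<integral>\<^sup>+ t \<in> {0..2 * pi}. e2ennreal (- w (z + of_real r * cis t)) \<partial>lborel)
       \<le> enn2ereal (\<integral>\<^sup>+ t \<in> {0..2 * pi}. e2ennreal (- v (z + of_real r * cis t)) \<partial>lborel)"
      unfolding less_eq_ennreal.rep_eq[symmetric] using le by (intro mono) simp
  qed simp
qed

lemma circle_mean_real:
  assumes g: "continuous_on (sphere z r) g" and r: "0 \<le> r"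
  shows "circle_mean (\<lambda>\<zeta>. ereal (g \<zeta>)) z r
       = ereal (1 / (2 * pi) * integral {0..2 * pi} (\<lambda>t. g (z + of_real r * cis t)))"
proof -
  define G where "G t = g (z + of_real r * cis t)" for t
  have "continuous_on {0..2*pi} G"
    unfolding G_def
    by (rule continuous_on_compose2[OF g]) (auto intro!: continuous_intros simp: dist_norm norm_mult r)
  then have int: "set_integrable lborel {0..2 * pi} G"
    using borel_integrable_atLeastAtMost'[of 0 "2*pi" G] by simp
  then have lint: "integrable lborel (\<lambda>t. indicator {0..2*pi} t * G t)"
    by (simp add: set_integrable_def)
  have pos: "(\<integral>\<^sup>+ t \<in> {0..2 * pi}. e2ennreal (ereal (s * G t)) \<partial>lborel) 
      = (\<integral>\<^sup>+ t. ennreal (s * (indicator {0..2*pi} t * G t)) \<partial>lborel)" for s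
    by (intro nn_integral_cong) (simp split: split_indicator)
  have fin: "(\<integral>\<^sup>+ t. ennreal (s * (indicator {0..2*pi} t * G t)) \<partial>lborel) < \<infinity>" for s
    using integrableD(2)[OF integrable_mult_right[OF lint, of s]] by (simp add: less_top)
  have "integral {0..2*pi} G = (LINT t:{0..2*pi}|lborel. G t)"
    using set_borel_integral_eq_integral[OF int] by simp
  also have "\<dots> = (LINT t|lborel. indicator {0..2*pi} t * G t)"
    by (simp add: set_lebesgue_integral_def)
  also have "\<dots> = enn2real (\<integral>\<^sup>+ t. ennreal (1 * (indicator {0..2*pi} t * G t)) \<partial>lborel)
       - enn2real (\<integral>\<^sup>+ t. ennreal ((-1) * (indicator {0..2*pi} t * G t)) \<partial>lborel)"
    using real_lebesgue_integral_def[OF lint] by simp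
  finally have eq: "integral {0..2*pi} G
      = enn2real (\<integral>\<^sup>+ t. ennreal (1 * (indicator {0..2*pi} t * G t)) \<partial>lborel)
       - enn2real (\<integral>\<^sup>+ t. ennreal ((-1) * (indicator {0..2*pi} t * G t)) \<partial>lborel)" .
  have real: "enn2ereal I = ereal (enn2real I)" if "I < \<infinity>" for I
    using that by (cases I rule: ennreal_cases) auto
  have "enn2ereal (\<integral>\<^sup>+ t. ennreal (1 * (indicator {0..2*pi} t * G t)) \<partial>lborel)
       - enn2ereal (\<integral>\<^sup>+ t. ennreal ((-1) * (indicator {0..2*pi} t * G t)) \<partial>lborel)
     = ereal (integral {0..2*pi} G)"
    unfolding eq real[OF fin[of 1]] real[OF fin[of "-1"]] by simp
  then have "enn2ereal (\<integral>\<^sup>+ t \<in> {0..2 * pi}. e2ennreal (ereal (G t)) \<partial>lborel)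
       - enn2ereal (\<integral>\<^sup>+ t \<in> {0..2 * pi}. e2ennreal (- ereal (G t)) \<partial>lborel)
     = ereal (integral {0..2*pi} G)"
    unfolding pos[of 1, symmetric] pos[of "-1", symmetric] by simp
  then show ?thesis
    unfolding circle_mean_def G_def[symmetric] by simp
qed

text \<open>Cauchy's integral formula at the centre of the circle.\<close>

lemma mean_value_holomorphic:
  fixes G :: "complex \<Rightarrow> complex"
  assumes G: "G holomorphic_on S" "cball z r \<subseteq> S" "open S" and r: "0 < r"
  shows "((\<lambda>t. G (z + of_real r * cis t)) has_integral (2 * pi * G z)) {0..2 * pi}"
proof -
  have "((\<lambda>u. G u / (u - z)) has_contour_integral (2 * of_real pi * \<i> * G z)) (circlepath z r)"
    using Cauchy_integral_circlepath_simple[of G z r z] G r holomorphic_on_subset by auto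
  then have "((\<lambda>t. G (z + r * cis t) / (z + r * cis t - z) * r * \<i> * cis t) has_integral
        (2 * of_real pi * \<i> * G z)) {0..2*pi}"
    unfolding circlepath_def by (subst (asm) has_contour_integral_part_circlepath_iff) auto
  then have "((\<lambda>t. \<i> * G (z + r * cis t)) has_integral (\<i> * (2 * of_real pi * G z))) {0..2*pi}"
    by (rule has_integral_eq_rhs[OF has_integral_eq, rotated]) (use r in \<open>auto simp: field_simps\<close>)
  then have "((\<lambda>t. (-\<i>) * (\<i> * G (z + r * cis t))) has_integral ((-\<i>) * (\<i> * (2 * of_real pi * G z)))) {0..2*pi}"
    by (rule has_integral_mult_right)
  then show ?thesis by (simp add: algebra_simps)
qed

lemma circle_mean_Re_holomorphic:
  fixes G :: "complex \<Rightarrow> complex"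
  assumes G: "G holomorphic_on S" "cball z r \<subseteq> S" "open S" and r: "0 < r"
  shows "circle_mean (\<lambda>\<zeta>. ereal (Re (G \<zeta>) + k)) z r = ereal (Re (G z) + k)"
proof -
  have "continuous_on (sphere z r) G"
    using G by (meson continuous_on_subset dual_order.trans holomorphic_on_imp_continuous_on sphere_cball)
  then have "circle_mean (\<lambda>\<zeta>. ereal (Re (G \<zeta>) + k)) z r
     = ereal (1 / (2 * pi) * integral {0..2 * pi} (\<lambda>t. Re (G (z + of_real r * cis t)) + k))"
    by (intro circle_mean_real) (use r in \<open>auto intro!: continuous_intros\<close>)
  also have "((\<lambda>t. Re (G (z + of_real r * cis t)) + k) has_integral (Re (2 * pi * G z) + 2 * pi * k)) {0..2 * pi}"
    using has_integral_add[OF has_integral_Re[OF mean_value_holomorphic[OF G r]]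
         has_integral_const_real[of k 0 "2*pi"]] by simp
  then have "integral {0..2 * pi} (\<lambda>t. Re (G (z + of_real r * cis t)) + k) = 2 * pi * (Re (G z) + k)"
    by (simp add: integral_unique algebra_simps)
  finally show ?thesis by simp
qed

text \<open>The only consequence of the sub-mean value property that is used later: comparison, on a single
  circle, with the real part of a holomorphic function, whose circle mean is its value at the centre.\<close>

lemma subharmonic_not_strictly_below_harmonic:
  fixes G :: "complex \<Rightarrow> complex"
  assumes v: "subharmonic_on S v" and r: "0 < r" "cball 0 r \<subseteq> S"
    and G: "G holomorphic_on T" "open T" "cball 0 r \<subseteq> T" and k: "k < 0"
    and fin: "\<bar>v 0\<bar> \<noteq> \<infinity>"
    and le: "\<And>\<zeta>. norm \<zeta> = r \<Longrightarrow> v \<zeta> \<le> v 0 + ereal (Re (G \<zeta>) - Re (G 0) + k)"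
  shows False
proof -
  obtain c where c: "v 0 = ereal c" using fin by (cases "v 0") auto
  have "v 0 \<le> circle_mean v 0 r"
    using v r unfolding subharmonic_on_def by blast
  also have "\<dots> \<le> circle_mean (\<lambda>\<zeta>. ereal (Re (G \<zeta>) + (c - Re (G 0) + k))) 0 r"
    by (rule circle_mean_mono) (use le r c in \<open>auto simp: algebra_simps\<close>)
  also have "\<dots> = ereal (Re (G 0) + (c - Re (G 0) + k))"
    by (rule circle_mean_Re_holomorphic) (use G r in auto)
  finally show False using k c by simp
qed

section \<open>Plurisubharmonic functions along holomorphic curves\<close>

definition usc_at :: "'x::topological_space \<Rightarrow> ('x \<Rightarrow> ereal) \<Rightarrow> bool" where
  "usc_at x g \<longleftrightarrow> (\<forall>c. g x < c \<longrightarrow> (\<forall>\<^sub>F y in nhds x. g y < c))"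

lemma usc_on_imp_open: "usc_on S u \<Longrightarrow> open S"
proof -
  assume u: "usc_on S u"
  then have "S = {z \<in> S. u z < \<infinity>}" by (auto simp: usc_on_def)
  also have "open \<dots>" using u unfolding usc_on_def by blast
  finally show ?thesis .
qed

lemma usc_on_imp_usc_at: "usc_on S u \<Longrightarrow> x \<in> S \<Longrightarrow> usc_at x u"
  unfolding usc_on_def usc_at_def eventually_nhds by blast

lemma usc_at_compose:
  assumes "isCont f x" "usc_at (f x) u"
  shows "usc_at x (\<lambda>y. u (f y))"
proof -
  have "filterlim f (nhds (f x)) (nhds x)"
    using assms(1) by (simp add: isCont_def tendsto_at_iff_tendsto_nhds)
  then show ?thesis
    using assms(2) unfolding usc_at_def by (auto simp: filterlim_iff)
qed

lemma usc_at_add_real: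
  assumes g: "usc_at x g" and q: "isCont q x" and fin: "g x < \<infinity>"
  shows "usc_at x (\<lambda>y. g y + ereal (q y))"
  unfolding usc_at_def
proof (intro allI impI)
  fix c assume c: "g x + ereal (q x) < c"
  obtain s t where st: "g x < ereal s" "q x < t" "ereal (s + t) \<le> c"
  proof (cases c)
    case (real c')
    show thesis
    proof (cases "g x")
      case (real g')
      then show thesis
        using c \<open>c = ereal c'\<close> 
        by (intro that[of "g' + (c' - g' - q x) / 2" "q x + (c' - g' - q x) / 2"]) (auto simp: field_simps)
    next
      case MInf
      then show thesis
        using \<open>c = ereal c'\<close> by (intro that[of "c' - q x - 1" "q x + 1"]) auto
    qed (use fin in auto)
  next
    case PInf
    obtain s where "g x < ereal s" using fin less_PInf_Ex_of_nat by fastforce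
    then show thesis using PInf by (intro that[of s "q x + 1"]) auto
  qed (use c in auto)
  have "\<forall>\<^sub>F y in nhds x. q y < t"
    using q st(2) by (simp add: isCont_def tendsto_at_iff_tendsto_nhds order_tendstoD(2))
  moreover have "\<forall>\<^sub>F y in nhds x. g y < ereal s"
    using g st(1) by (simp add: usc_at_def)
  ultimately show "\<forall>\<^sub>F y in nhds x. g y + ereal (q y) < c"
  proof eventually_elim
    case (elim y)
    then have "g y + ereal (q y) < ereal s + ereal t" by (intro ereal_add_strict_mono2) auto
    then show ?case using st(3) by (simp add: less_le_trans)
  qed
qed

lemma usc_attains_max:
  fixes g :: "'x::topological_space \<Rightarrow> ereal"
  assumes K: "compact K" "K \<noteq> {}" and g: "\<And>x. x \<in> K \<Longrightarrow> usc_at x g"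
  obtains x where "x \<in> K" "\<And>y. y \<in> K \<Longrightarrow> g y \<le> g x"
proof (rule ccontr)
  assume "\<not> thesis"
  then have "\<forall>x\<in>K. \<exists>y\<in>K. g x < g y" using that by (meson not_le)
  moreover have "\<exists>N. open N \<and> x \<in> N \<and> (\<forall>z\<in>N. g z < g y)" if "x \<in> K" "g x < g y" for x y
    using g[OF that(1)] that(2) unfolding usc_at_def eventually_nhds by blast
  ultimately have "\<forall>x\<in>K. \<exists>y N. y \<in> K \<and> open N \<and> x \<in> N \<and> (\<forall>z\<in>N. g z < g y)" by meson
  then obtain Y N where YN: "\<And>x. x \<in> K \<Longrightarrow> Y x \<in> K" "\<And>x. x \<in> K \<Longrightarrow> open (N x)"
      "\<And>x. x \<in> K \<Longrightarrow> x \<in> N x" "\<And>x z. x \<in> K \<Longrightarrow> z \<in> N x \<Longrightarrow> g z < g (Y x)"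
    by metis
  obtain C where C: "C \<subseteq> K" "finite C" "K \<subseteq> (\<Union>x\<in>C. N x)"
    by (rule compactE_image[OF K(1), of K N]) (use YN in auto)
  have "C \<noteq> {}" using C K by auto
  then obtain x where x: "x \<in> C" "\<And>y. y \<in> C \<Longrightarrow> g (Y y) \<le> g (Y x)"
    using obtains_MAX[of C "\<lambda>x. g (Y x)"] C(2) 
    by (metis (no_types, lifting) Max_ge finite_imageI image_eqI)
  obtain y where "y \<in> C" "Y x \<in> N y" using C YN(1) x(1) by blast
  then have "g (Y x) < g (Y y)" using YN(4) C by blast
  then show False using x(2)[OF \<open>y \<in> C\<close>] by simp
qed

text \<open>The derivative is recorded as a tangent vector \<open>w\<close>, because the complex line spanned by
  \<open>w\<close> is where a plurisubharmonic function will be tested.\<close>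

definition holo_curve_on :: "complex set \<Rightarrow> (complex \<Rightarrow> complex ^ 'n::finite) \<Rightarrow> bool" where
  "holo_curve_on T f \<longleftrightarrow> open T \<and> (\<forall>\<zeta>\<in>T. \<exists>w. (f has_derivative (\<lambda>\<tau>. \<tau> *s w)) (at \<zeta>))"

lemma holo_curve_on_nth:
  assumes "holo_curve_on T f" shows "(\<lambda>\<zeta>. f \<zeta> $ i) holomorphic_on T"
proof -
  have "(\<lambda>\<zeta>. f \<zeta> $ i) field_differentiable at \<zeta>" if \<zeta>: "\<zeta> \<in> T" for \<zeta>
  proof -
    obtain w where "(f has_derivative (\<lambda>\<tau>. \<tau> *s w)) (at \<zeta>)"
      using assms \<zeta> by (auto simp: holo_curve_on_def)
    then have "((\<lambda>\<zeta>. f \<zeta> $ i) has_derivative (\<lambda>\<tau>. (\<tau> *s w) $ i)) (at \<zeta>)"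
      by (rule bounded_linear.has_derivative[OF bounded_linear_vec_nth])
    then have "((\<lambda>\<zeta>. f \<zeta> $ i) has_field_derivative (w $ i)) (at \<zeta>)"
      by (simp add: has_field_derivative_def mult.commute[of _ "w $ i"])
    then show ?thesis unfolding field_differentiable_def ..
  qed
  then show ?thesis by (meson field_differentiable_at_within holomorphic_onI)
qed

lemma holo_curve_on_isCont: "holo_curve_on T f \<Longrightarrow> \<zeta> \<in> T \<Longrightarrow> isCont f \<zeta>"
  unfolding holo_curve_on_def using has_derivative_continuous by blast

text \<open>The mixed term is displayed as the real part of an expression that is complex linear in
  \<open>y\<close>, hence holomorphic if \<open>y\<close> depends holomorphically on a parameter.\<close>

lemma norm_vec_diff_sq:
  fixes x y :: "complex ^ 'n::finite"
  shows "(norm (x - y))\<^sup>2 = (norm x)\<^sup>2 - 2 * Re (\<Sum>i\<in>UNIV. cnj (x $ i) * y $ i) + (norm y)\<^sup>2"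
proof -
  have "x \<bullet> y = Re (\<Sum>i\<in>UNIV. cnj (x $ i) * y $ i)"
    by (simp add: inner_vec_def inner_complex_def)
  then show ?thesis
    by (simp add: power2_norm_eq_inner inner_diff inner_commute)
qed

lemma norm_complex_diff_sq:
  "(norm (a + b))\<^sup>2 = (norm a)\<^sup>2 + 2 * Re (cnj a * b) + (norm (b::complex))\<^sup>2"
  unfolding cmod_power2 by (simp add: power2_eq_square algebra_simps)

text \<open>The composition of a plurisubharmonic function \<open>u\<close> with a holomorphic curve \<open>f\<close> is
  subharmonic, in the following viscosity form: no function \<open>Re L - c |\<zeta> - \<zeta>0|\<^sup>2\<close>
  with \<open>L\<close> holomorphic and \<open>c > 0\<close>, which is strictly superharmonic, can touch
  \<open>u \<circ> f\<close> from above at \<open>\<zeta>0\<close>. The definition gives information about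
  \<open>u\<close> on complex lines only, whereas \<open>f\<close> is curved. Smoothing of \<open>u\<close> by
  convolution is avoided by doubling the variables. In a small ball around
  \<open>(\<zeta>0, f \<zeta>0)\<close> let
  \<open>\<Phi> N (\<zeta>, z) = u z - q \<zeta> - N |z - f \<zeta>|\<^sup>2\<close>, where \<open>q\<close> is the
  touching function with \<open>c\<close> replaced by \<open>c/2\<close>. As \<open>N\<close> grows, the penalty
  forces \<open>z\<close> close to \<open>f \<zeta>\<close>, and the half of the quadratic term that was given
  away forces \<open>\<zeta>\<close> close to \<open>\<zeta>0\<close>; hence for some \<open>N\<close> the maximum
  of \<open>\<Phi> N\<close> is attained at an interior point \<open>(\<zeta>1, z1)\<close>.

  Now move both variables at once along the complex line with direction \<open>(1, w)\<close>, where
  \<open>w\<close> is the derivative of \<open>f\<close> at \<open>\<zeta>1\<close>. The difference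
  \<open>z - f \<zeta>\<close> then changes by \<open>- h \<tau>\<close> with \<open>h\<close> holomorphic and of
  order \<open>o(\<tau>)\<close>, so its square is the real part of a holomorphic function up to the
  negligible term \<open>|h \<tau>|\<^sup>2\<close>. Thus the maximum property bounds \<open>u\<close> on the line
  \<open>z1 + \<tau> w\<close> by its value at \<open>z1\<close> plus the real part of a holomorphic function
  minus a positive multiple of \<open>|\<tau>|\<^sup>2\<close>, which contradicts the sub-mean value property
  on this line.\<close>

lemma psh_no_strict_contact:
  fixes u :: "complex ^ 'n::finite \<Rightarrow> ereal" and f :: "complex \<Rightarrow> complex ^ 'n"
  assumes u: "psh_vec_on S u" and f: "holo_curve_on T f"
    and \<zeta>0: "\<zeta>0 \<in> T" "f \<zeta>0 \<in> S" and L: "L holomorphic_on T" and c: "c > 0"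
    and fin: "\<bar>u (f \<zeta>0)\<bar> \<noteq> \<infinity>"
    and contact: "\<And>\<zeta>. \<zeta> \<in> T \<Longrightarrow> f \<zeta> \<in> S \<Longrightarrow>
           u (f \<zeta>) \<le> u (f \<zeta>0) + ereal (Re (L \<zeta>) - Re (L \<zeta>0) - c * (norm (\<zeta> - \<zeta>0))\<^sup>2)"
  shows False
proof -
  have usc: "usc_on S u" and T: "open T"
    using u f by (auto simp: psh_vec_on_def holo_curve_on_def)
  have S: "open S" by (rule usc_on_imp_open[OF usc])
  have u_lt: "u z < \<infinity>" if "z \<in> S" for z using usc that by (auto simp: usc_on_def)
  obtain m where m: "u (f \<zeta>0) = ereal m" using fin by (cases "u (f \<zeta>0)") auto
  define P where "P = (\<zeta>0, f \<zeta>0)"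
  have "open (T \<times> S)" "P \<in> T \<times> S" using T S \<zeta>0 by (auto simp: P_def open_Times)
  then obtain s where s: "s > 0" "cball P s \<subseteq> T \<times> S" by (meson open_contains_cball)
  define q where "q \<zeta> = Re (L \<zeta>) - Re (L \<zeta>0) - c / 2 * (norm (\<zeta> - \<zeta>0))\<^sup>2" for \<zeta>
  define Q where "Q N x = q (fst x) + N * (norm (snd x - f (fst x)))\<^sup>2" for N and x :: "complex \<times> (complex ^ 'n)"
  define \<Phi> where "\<Phi> N x = u (snd x) + ereal (- Q (real N) x)" for N x
  have Lcont: "isCont L \<zeta>" if "\<zeta> \<in> T" for \<zeta>
    using L T that holomorphic_on_imp_continuous_on continuous_on_eq_continuous_at by blast
  have usc_\<Phi>: "usc_at x (\<Phi> N)" if x: "x \<in> T \<times> S" for x N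
    unfolding \<Phi>_def
  proof (rule usc_at_add_real)
    have fst_snd: "isCont fst x" "isCont snd x"
      using isCont_fst[OF continuous_ident] isCont_snd[OF continuous_ident] by auto
    show "usc_at x (\<lambda>y. u (snd y))"
      by (rule usc_at_compose[OF fst_snd(2)], rule usc_on_imp_usc_at[OF usc]) (use x in auto)
    have "fst x \<in> T" using x by auto
    then have "isCont (\<lambda>x. L (fst x)) x" "isCont (\<lambda>x. f (fst x)) x"
      by (rule isCont_o2[OF fst_snd(1) Lcont], rule isCont_o2[OF fst_snd(1) holo_curve_on_isCont[OF f]])
    with fst_snd show "isCont (\<lambda>x. - Q (real N) x) x"
      unfolding Q_def q_def by (intro continuous_intros isCont_Re)
  qed (use x u_lt in auto)
  have \<Phi>_P: "\<Phi> N P = ereal m" for N by (simp add: \<Phi>_def P_def Q_def q_def m)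
  have \<Phi>_mono: "\<Phi> N x \<le> \<Phi> M x" if "M \<le> N" for M N x
    unfolding \<Phi>_def Q_def using that by (intro add_mono) (auto intro!: mult_right_mono)

  \<comment> \<open>Otherwise some point of the sphere has \<open>\<Phi> M \<ge> m\<close> for every \<open>M\<close>, by compactness and
      because \<open>\<Phi> N\<close> decreases with \<open>N\<close>. Such a point lies on the graph of \<open>f\<close>, where
      the strictness of the contact allows only the centre.\<close>
  have "\<exists>N. \<forall>x\<in>sphere P s. \<Phi> N x < ereal m"
  proof (rule ccontr)
    assume "\<not> ?thesis"
    then obtain X where X: "\<And>N. X N \<in> sphere P s" "\<And>N. ereal m \<le> \<Phi> N (X N)"
      by (metis not_le)
    obtain x r where x: "x \<in> sphere P s" and r: "strict_mono r" "(X \<circ> r) \<longlonglongrightarrow> x"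
      using compact_sphere[of P s] X(1) unfolding compact_def by metis
    have xTS: "x \<in> T \<times> S" using x s sphere_cball by blast
    have ge: "ereal m \<le> \<Phi> M x" for M
    proof (rule ccontr)
      assume "\<not> ereal m \<le> \<Phi> M x"
      then have "\<forall>\<^sub>F y in nhds x. \<Phi> M y < ereal m"
        using usc_\<Phi>[OF xTS, of M] by (simp add: usc_at_def)
      then have "\<forall>\<^sub>F n in sequentially. \<Phi> M (X (r n)) < ereal m"
        using eventually_compose_filterlim[OF _ r(2)] by (simp add: o_def)
      moreover have "\<forall>\<^sub>F n in sequentially. M \<le> r n"
        by (rule eventually_compose_filterlim[OF eventually_ge_at_top filterlim_subseq[OF r(1)]])
      ultimately have "\<forall>\<^sub>F n in sequentially. False"
      proof eventually_elim
        case (elim n)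
        then show False using X(2)[of "r n"] \<Phi>_mono[of M "r n" "X (r n)"] by simp
      qed
      then show False by simp
    qed
    obtain \<zeta> z where xz: "x = (\<zeta>, z)" by (cases x)
    have "u z < \<infinity>" using u_lt xTS xz by auto
    moreover have "u z \<noteq> -\<infinity>" using ge[of 0] by (auto simp: \<Phi>_def xz)
    ultimately obtain y where y: "u z = ereal y" by (cases "u z") auto
    have ge': "m \<le> y - q \<zeta> - real M * (norm (z - f \<zeta>))\<^sup>2" for M
      using ge[of M] by (simp add: \<Phi>_def xz y Q_def)
    have "z = f \<zeta>"
    proof (rule ccontr)
      assume "z \<noteq> f \<zeta>"
      then have "(norm (z - f \<zeta>))\<^sup>2 > 0" by simp
      then obtain M where "y - q \<zeta> - m < real M * (norm (z - f \<zeta>))\<^sup>2"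
        using reals_Archimedean3 by blast
      then show False using ge'[of M] by simp
    qed
    then have "y \<le> m + (Re (L \<zeta>) - Re (L \<zeta>0) - c * (norm (\<zeta> - \<zeta>0))\<^sup>2)"
      using contact[of \<zeta>] xTS xz m y by simp
    then have "c * (norm (\<zeta> - \<zeta>0))\<^sup>2 \<le> 0"
      using ge'[of 0] by (simp add: q_def)
    then have "\<zeta> = \<zeta>0" using c by (simp add: mult_le_0_iff)
    then show False using x s(1) xz \<open>z = f \<zeta>\<close> by (simp add: P_def)
  qed
  then obtain N where N: "\<And>x. x \<in> sphere P s \<Longrightarrow> \<Phi> N x < ereal m" by blast
  obtain x where x: "x \<in> cball P s" "\<And>y. y \<in> cball P s \<Longrightarrow> \<Phi> N y \<le> \<Phi> N x"
  proof (rule usc_attains_max[of "cball P s" "\<Phi> N"])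
    show "usc_at x (\<Phi> N)" if "x \<in> cball P s" for x
      using usc_\<Phi> s(2) that by blast
  qed (use s(1) in auto)
  have xm: "ereal m \<le> \<Phi> N x" using x(2)[of P] s \<Phi>_P by auto
  then have xball: "x \<in> ball P s" using x(1) N[of x] by (cases "dist P x = s") auto
  obtain \<zeta>1 z1 where xz: "x = (\<zeta>1, z1)" by (cases x)
  have in_TS: "\<zeta>1 \<in> T" "z1 \<in> S" using x(1) s xz by auto
  have "u z1 \<noteq> -\<infinity>" using xm by (auto simp: \<Phi>_def xz)
  then obtain y1 where y1: "u z1 = ereal y1" using u_lt[OF in_TS(2)] by (cases "u z1") auto
  have max: "u z \<le> ereal (y1 + (Q N (\<zeta>, z) - Q N (\<zeta>1, z1)))" if "(\<zeta>, z) \<in> ball P s" for \<zeta> z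
    using x(2)[of "(\<zeta>, z)"] that by (cases "u z") (auto simp: \<Phi>_def xz y1)

  obtain w where w: "(f has_derivative (\<lambda>\<tau>. \<tau> *s w)) (at \<zeta>1)"
    using f in_TS unfolding holo_curve_on_def by blast
  define h where "h \<tau> = f (\<zeta>1 + \<tau>) - f \<zeta>1 - \<tau> *s w" for \<tau>
  define g0 where "g0 = z1 - f \<zeta>1"
  \<comment> \<open>With this slope for \<open>h\<close> the error \<open>N |h \<tau>|\<^sup>2\<close> eats up only half of the
      available \<open>c/2 |\<tau>|\<^sup>2\<close>.\<close>
  define e where "e = min 1 (c / (4 * (real N + 1)))"
  have e: "e > 0" "real N * e\<^sup>2 \<le> c / 4"
  proof -
    show "e > 0" using c by (simp add: e_def)
    have "e \<le> 1" "e \<le> c / (4 * (real N + 1))" unfolding e_def by (rule min.cobounded1 min.cobounded2)+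
    moreover have "e\<^sup>2 \<le> e"
      using mult_left_le[OF \<open>e \<le> 1\<close>, of e] \<open>e > 0\<close> by (simp add: power2_eq_square)
    ultimately have "real N * e\<^sup>2 \<le> (real N + 1) * (c / (4 * (real N + 1)))"
      by (intro mult_mono) auto
    also have "\<dots> = c / 4" using of_nat_0_le_iff[of N] by (simp add: divide_simps)
    finally show "real N * e\<^sup>2 \<le> c / 4" .
  qed
  obtain d1 where d1: "d1 > 0" "\<And>\<tau>. norm \<tau> < d1 \<Longrightarrow> norm (h \<tau>) \<le> e * norm \<tau>"
  proof -
    obtain d where "d > 0" "\<forall>y. norm (y - \<zeta>1) < d \<longrightarrow> norm (f y - f \<zeta>1 - (y - \<zeta>1) *s w) \<le> e * norm (y - \<zeta>1)"
      using w e(1) unfolding has_derivative_at_alt by meson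
    then show thesis by (intro that[of d]) (auto simp: h_def dest: spec[of _ "\<zeta>1 + _"])
  qed
  have "isCont (\<lambda>\<tau>. \<tau> *s w) 0"
    by (rule linear_continuous_at[OF has_derivative_bounded_linear[OF w]])
  then have "isCont (\<lambda>\<tau>. (\<zeta>1 + \<tau>, z1 + \<tau> *s w)) 0"
    by (intro continuous_intros)
  then have "filterlim (\<lambda>\<tau>. (\<zeta>1 + \<tau>, z1 + \<tau> *s w)) (nhds (\<zeta>1, z1)) (nhds 0)"
    using tendsto_at_iff_tendsto_nhds[of "\<lambda>\<tau>. (\<zeta>1 + \<tau>, z1 + \<tau> *s w)" 0]
    unfolding isCont_def by simp
  then have "\<forall>\<^sub>F \<tau> in nhds 0. (\<zeta>1 + \<tau>, z1 + \<tau> *s w) \<in> ball P s"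
    using eventually_compose_filterlim[OF eventually_nhds_in_open[OF open_ball xball]] xz by auto
  then obtain d2 where d2: "d2 > 0" "\<And>\<tau>. norm \<tau> < d2 \<Longrightarrow> (\<zeta>1 + \<tau>, z1 + \<tau> *s w) \<in> ball P s"
    unfolding eventually_nhds_metric by (auto simp: dist_norm)
  define r where "r = min d1 d2 / 2"
  have r: "r > 0" "r < d1" "r < d2" using d1 d2 by (auto simp: r_def)
  \<comment> \<open>\<open>Re G\<close> collects the harmonic part of the change of \<open>q + N |z - f \<zeta>|\<^sup>2\<close> along
      the line: the three terms come from \<open>L\<close>, from the square centred at \<open>\<zeta>0\<close>
      rather than \<open>\<zeta>1\<close>, and from the mixed term of the penalty.\<close>
  define G where "G \<tau> = L (\<zeta>1 + \<tau>) - of_real c * (cnj (\<zeta>1 - \<zeta>0) * \<tau>)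
      - 2 * of_nat N * (\<Sum>i\<in>UNIV. cnj (g0 $ i) * h \<tau> $ i)" for \<tau>
  have inT: "\<zeta>1 + \<tau> \<in> T" and inS: "z1 + \<tau> *s w \<in> S" if "\<tau> \<in> ball 0 d2" for \<tau>
    using subsetD[OF s(2), of "(\<zeta>1 + \<tau>, z1 + \<tau> *s w)"] d2(2)[of \<tau>] that by auto
  show False
  proof (rule subharmonic_not_strictly_below_harmonic)
    show "subharmonic_on {\<tau>. z1 + \<tau> *s w \<in> S} (\<lambda>\<tau>. u (z1 + \<tau> *s w))"
      using u unfolding psh_vec_on_def by blast
    show "cball 0 r \<subseteq> {\<tau>. z1 + \<tau> *s w \<in> S}" "cball 0 r \<subseteq> ball 0 d2" using inS r by auto
    have sub: "((+) \<zeta>1) ` ball 0 d2 \<subseteq> T" unfolding image_subset_iff using inT by blast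
    have "((+) \<zeta>1) holomorphic_on ball 0 d2" by (intro holomorphic_intros)
    then have shift: "(\<lambda>\<tau>. g (\<zeta>1 + \<tau>)) holomorphic_on ball 0 d2" if "g holomorphic_on T" for g
      using holomorphic_on_compose_gen[OF _ that sub] by (simp add: o_def)
    show "G holomorphic_on ball 0 d2"
      unfolding G_def h_def vector_minus_component vector_smult_component
      by (intro holomorphic_intros shift[OF L] shift[OF holo_curve_on_nth[OF f]])
    show "- (c / 4 * r\<^sup>2) < 0" using c r by simp
    show "u (z1 + \<tau> *s w) \<le> u (z1 + 0 *s w) + ereal (Re (G \<tau>) - Re (G 0) + - (c / 4 * r\<^sup>2))"
      if \<tau>: "norm \<tau> = r" for \<tau>
    proof -
      have "(norm (h \<tau>))\<^sup>2 \<le> (e * r)\<^sup>2" using d1(2)[of \<tau>] r \<tau> by (intro power_mono) auto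
      then have "real N * (norm (h \<tau>))\<^sup>2 \<le> real N * e\<^sup>2 * r\<^sup>2"
        by (simp add: power_mult_distrib mult_left_mono mult.assoc)
      also have "\<dots> \<le> c / 4 * r\<^sup>2" using e(2) by (intro mult_right_mono) auto
      finally have h: "real N * (norm (h \<tau>))\<^sup>2 \<le> c / 4 * r\<^sup>2" .
      have pen: "(norm (z1 + \<tau> *s w - f (\<zeta>1 + \<tau>)))\<^sup>2
          = (norm g0)\<^sup>2 - 2 * Re (\<Sum>i\<in>UNIV. cnj (g0 $ i) * h \<tau> $ i) + (norm (h \<tau>))\<^sup>2"
        using norm_vec_diff_sq[of g0 "h \<tau>"] by (simp add: g0_def h_def algebra_simps)
      have quad: "(norm (\<zeta>1 + \<tau> - \<zeta>0))\<^sup>2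
          = (norm (\<zeta>1 - \<zeta>0))\<^sup>2 + 2 * Re (cnj (\<zeta>1 - \<zeta>0) * \<tau>) + r\<^sup>2"
        using norm_complex_diff_sq[of "\<zeta>1 - \<zeta>0" \<tau>] \<tau> by (simp add: algebra_simps)
      have h0: "h 0 = 0" by (simp add: h_def)
      have "Q N (\<zeta>1 + \<tau>, z1 + \<tau> *s w) - Q N (\<zeta>1, z1)
          = Re (G \<tau>) - Re (G 0) - c / 2 * r\<^sup>2 + real N * (norm (h \<tau>))\<^sup>2"
        unfolding Q_def q_def fst_conv snd_conv pen quad
        by (simp add: G_def h0 g0_def[symmetric] algebra_simps)
      then have "y1 + (Q N (\<zeta>1 + \<tau>, z1 + \<tau> *s w) - Q N (\<zeta>1, z1))
          \<le> y1 + (Re (G \<tau>) - Re (G 0) + - (c / 4 * r\<^sup>2))"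
        using h by simp
      moreover have "u (z1 + \<tau> *s w) \<le> ereal (y1 + (Q N (\<zeta>1 + \<tau>, z1 + \<tau> *s w) - Q N (\<zeta>1, z1)))"
        using d2(2)[of \<tau>] r \<tau> by (intro max) auto
      ultimately show ?thesis
        using y1 by (simp add: order_trans)
    qed
    show "\<bar>u (z1 + 0 *s w)\<bar> \<noteq> \<infinity>" using y1 by simp
  qed (use r(1) in simp_all)
qed

section \<open>A Liouville theorem in the plane\<close>

text \<open>The second clause says that no strictly superharmonic function of the form
  \<open>Re L - c |z - z0|\<^sup>2\<close> touches \<open>v\<close> from above. This notion is local, and it
  suffices for the maximum principle, so that the integral inequality need not be transported along
  curves.\<close>

definition viscosity_subharmonic :: "(complex \<Rightarrow> ereal) \<Rightarrow> bool" where
  "viscosity_subharmonic v \<longleftrightarrow> (\<forall>z. usc_at z v) \<and>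
     (\<forall>z0 T L c. open T \<longrightarrow> z0 \<in> T \<longrightarrow> L holomorphic_on T \<longrightarrow> 0 < c \<longrightarrow> \<bar>v z0\<bar> \<noteq> \<infinity> \<longrightarrow>
        (\<exists>z\<in>T. v z0 + ereal (Re (L z) - Re (L z0) - c * (norm (z - z0))\<^sup>2) < v z))"

text \<open>Compare \<open>v\<close> with \<open>\<epsilon> ln |w - a|\<close> in an annulus around \<open>a\<close>: on the
  outer circle the logarithm wins because \<open>v < 0\<close>, on a small inner circle \<open>v\<close> is
  at most slightly larger than \<open>v a\<close> by upper semicontinuity. If \<open>v z\<close> were larger
  than \<open>v a\<close>, the difference would have an interior maximum. The term
  \<open>\<eta> |w - a|\<^sup>2\<close> makes the comparison function strictly superharmonic, so that such a
  maximum is a forbidden contact. Since \<open>a\<close> and \<open>z\<close> can be exchanged,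
  \<open>v\<close> is constant.\<close>

lemma viscosity_subharmonic_negative_imp_le:
  assumes v: "viscosity_subharmonic v" and neg: "\<And>z. v z < 0"
  shows "v z \<le> v a"
proof (rule ccontr)
  assume "\<not> v z \<le> v a"
  then have "v a < v z" by simp
  then obtain c where c: "v a < ereal c" "ereal c < v z" using ereal_dense2 by blast
  obtain y where y: "v z = ereal y" using c neg[of z] by (cases "v z") auto
  have cy: "c < y" "y < 0" using c neg[of z] y by auto
  have usc: "usc_at w v" for w using v by (simp add: viscosity_subharmonic_def)
  obtain d where d: "d > 0" "\<And>w. dist w a < d \<Longrightarrow> v w < ereal c"
    using usc[of a] c(1) unfolding usc_at_def eventually_nhds_metric by blast
  define \<rho> where "\<rho> = d / 2"
  have \<rho>: "\<rho> > 0" "\<And>w. norm (w - a) \<le> \<rho> \<Longrightarrow> v w < ereal c"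
    using d by (auto simp: \<rho>_def dist_norm)
  have z\<rho>: "\<rho> < norm (z - a)"
    using \<rho>(2)[of z] c(2) by (meson less_asym not_le)
  define l where "l = ln (norm (z - a) / \<rho>)"
  have l: "l > 0" unfolding l_def using z\<rho> \<rho>(1) by (intro ln_gt_zero) simp
  \<comment> \<open>The gap \<open>y - c\<close> is split into thirds: the logarithm costs one third at \<open>z\<close>, the
      quadratic term gains at most one third on the inner circle, and one third remains.\<close>
  define \<epsilon> where "\<epsilon> = (y - c) / (3 * l)"
  have \<epsilon>: "\<epsilon> > 0" "\<epsilon> * l = (y - c) / 3" using l cy by (auto simp: \<epsilon>_def)
  \<comment> \<open>On the outer circle the logarithmic term is exactly \<open>|c| + 1\<close>; the quadratic term gives
      back at most 1.\<close>
  define R where "R = \<rho> * exp ((\<bar>c\<bar> + 1) / \<epsilon>)"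
  have lnR: "\<epsilon> * ln (R / \<rho>) = \<bar>c\<bar> + 1" using \<rho>(1) \<epsilon>(1) by (simp add: R_def)
  have \<rho>R: "\<rho> < R" using \<rho>(1) \<epsilon>(1) by (simp add: R_def)
  have zR: "norm (z - a) < R"
  proof -
    have "\<epsilon> * l < \<epsilon> * ln (R / \<rho>)" using \<epsilon>(2) lnR cy by (simp add: field_simps)
    then have "ln (norm (z - a) / \<rho>) < ln (R / \<rho>)" using \<epsilon>(1) by (simp add: l_def)
    moreover have "0 < norm (z - a) / \<rho>"
      using less_trans[OF \<rho>(1) z\<rho>] \<rho>(1) by (rule divide_pos_pos)
    moreover have "0 < R / \<rho>" using less_trans[OF \<rho>(1) \<rho>R] \<rho>(1) by (rule divide_pos_pos)
    ultimately have "norm (z - a) / \<rho> < R / \<rho>" by (simp only: ln_less_cancel_iff)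
    then show ?thesis using \<rho>(1) by (simp add: divide_less_cancel)
  qed
  define \<eta> where "\<eta> = min ((y - c) / 3) 1 / R\<^sup>2"
  have R: "R > 0" using \<rho>(1) \<rho>R by simp
  have "\<eta> * R\<^sup>2 = min ((y - c) / 3) 1" using R by (simp add: \<eta>_def)
  then have \<eta>R: "\<eta> * R\<^sup>2 \<le> (y - c) / 3" "\<eta> * R\<^sup>2 \<le> 1" by linarith+
  have \<eta>: "\<eta> > 0" using cy R by (simp add: \<eta>_def)
  define q where "q w = \<eta> * (norm (w - a))\<^sup>2 - \<epsilon> * ln (norm (w - a) / \<rho>)" for w
  define \<Psi> where "\<Psi> w = v w + ereal (q w)" for w
  define K where "K = {w. \<rho> \<le> norm (w - a) \<and> norm (w - a) \<le> R}"
  have K: "compact K"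
  proof -
    have "K = cball a R - ball a \<rho>" by (auto simp: K_def dist_norm norm_minus_commute)
    then show ?thesis by (simp add: compact_diff)
  qed
  have zK: "z \<in> K" using z\<rho> zR by (simp add: K_def)
  have "usc_at w \<Psi>" if "w \<in> K" for w
    unfolding \<Psi>_def
  proof (rule usc_at_add_real[OF usc])
    have "w \<noteq> a" using that \<rho>(1) by (auto simp: K_def)
    then show "isCont q w"
      unfolding q_def using \<rho>(1) by (intro continuous_intros) auto
    show "v w < \<infinity>" using neg[of w] by auto
  qed
  then obtain z0 where z0: "z0 \<in> K" "\<And>w. w \<in> K \<Longrightarrow> \<Psi> w \<le> \<Psi> z0"
    using usc_attains_max[OF K, of \<Psi>] zK by blast
  have "\<Psi> z \<le> \<Psi> z0" using z0(2) zK by blast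
  moreover have "ereal (c + 2 * (y - c) / 3) \<le> \<Psi> z"
    using \<epsilon>(2) \<eta> by (simp add: \<Psi>_def y q_def l_def[symmetric] field_simps)
  ultimately have \<Psi>z0: "ereal (c + 2 * (y - c) / 3) \<le> \<Psi> z0" by simp
  have "norm (z0 - a) \<noteq> \<rho>"
  proof
    assume eq: "norm (z0 - a) = \<rho>"
    have "\<eta> * \<rho>\<^sup>2 \<le> \<eta> * R\<^sup>2" using \<eta> \<rho>(1) \<rho>R by (intro mult_left_mono power_mono) auto
    then have "q z0 \<le> (y - c) / 3" using \<eta>R(1) \<rho>(1) by (simp add: q_def eq)
    moreover have "v z0 < ereal c" using \<rho>(2) eq by simp
    ultimately have "\<Psi> z0 < ereal (c + (y - c) / 3)"
      unfolding \<Psi>_def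
      by (cases "v z0") (auto simp del: divide_le_eq_numeral1 le_divide_eq_numeral1 intro: add_less_le_mono)
    then have "ereal (c + 2 * (y - c) / 3) < ereal (c + (y - c) / 3)" using \<Psi>z0 by (rule le_less_trans[rotated])
    then show False using cy by (simp add: field_simps)
  qed
  moreover have "norm (z0 - a) \<noteq> R"
  proof
    assume eq: "norm (z0 - a) = R"
    then have "q z0 \<le> c" using lnR \<eta>R(2) by (simp add: q_def)
    moreover have "v z0 < 0" by (rule neg)
    ultimately have "\<Psi> z0 < ereal c"
      unfolding \<Psi>_def by (cases "v z0") auto
    then have "ereal (c + 2 * (y - c) / 3) < ereal c" using \<Psi>z0 by (rule le_less_trans[rotated])
    then show False using cy by (simp add: field_simps)
  qed
  ultimately have z0K: "\<rho> < norm (z0 - a)" "norm (z0 - a) < R" using z0(1) by (auto simp: K_def)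
  have z0a: "z0 \<noteq> a" using z0K \<rho>(1) by auto
  have fin: "\<bar>v z0\<bar> \<noteq> \<infinity>" using \<Psi>z0 neg[of z0] by (cases "v z0") (auto simp: \<Psi>_def)
  \<comment> \<open>On the ball around \<open>z0\<close> that reaches to \<open>a\<close> the quotient
      \<open>(w - a) / (z0 - a)\<close> lies in the right half-plane, so its principal logarithm is
      holomorphic.\<close>
  define T where "T = ball z0 (norm (z0 - a)) \<inter> {w. \<rho> < norm (w - a)} \<inter> {w. norm (w - a) < R}"
  define L where "L w = of_real \<epsilon> * Ln ((w - a) / (z0 - a)) - of_real (2 * \<eta>) * (cnj (z0 - a) * (w - z0))" for w
  have "open T"
    unfolding T_def by (intro open_Int open_ball open_Collect_less continuous_intros)
  moreover have "z0 \<in> T" using z0K z0a by (simp add: T_def)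
  moreover have "L holomorphic_on T"
  proof -
    have "(w - a) / (z0 - a) \<notin> \<real>\<^sub>\<le>\<^sub>0" if "w \<in> T" for w
    proof -
      have "norm ((w - z0) / (z0 - a)) < 1"
        using that z0a by (simp add: T_def norm_divide dist_norm norm_minus_commute)
      then have "Re ((w - z0) / (z0 - a)) > -1"
        using abs_Re_le_cmod[of "(w - z0) / (z0 - a)"] by linarith
      moreover have "(w - a) / (z0 - a) = 1 + (w - z0) / (z0 - a)"
        using z0a by (simp add: field_simps)
      ultimately show ?thesis by (auto simp: complex_nonpos_Reals_iff)
    qed
    then show ?thesis unfolding L_def using z0a by (intro holomorphic_intros) auto
  qed
  ultimately obtain w where w: "w \<in> T" and
      less: "v z0 + ereal (Re (L w) - Re (L z0) - \<eta> * (norm (w - z0))\<^sup>2) < v w"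
    using v fin \<eta> unfolding viscosity_subharmonic_def by meson
  have wa: "w \<noteq> a" using w \<rho>(1) by (auto simp: T_def)
  define A where "A = Re (cnj (z0 - a) * (w - z0))"
  have L0: "Re (L z0) = 0" using z0a by (simp add: L_def)
  have Lw: "Re (L w) = \<epsilon> * (ln (norm (w - a)) - ln (norm (z0 - a))) - 2 * \<eta> * A"
    using wa z0a by (simp add: L_def A_def norm_divide ln_div)
  have quad: "(norm (w - a))\<^sup>2 = (norm (z0 - a))\<^sup>2 + 2 * A + (norm (w - z0))\<^sup>2"
    using norm_complex_diff_sq[of "z0 - a" "w - z0"] by (simp add: A_def)
  have "q z0 - q w = \<eta> * ((norm (z0 - a))\<^sup>2 - (norm (w - a))\<^sup>2)
      + \<epsilon> * (ln (norm (w - a)) - ln (norm (z0 - a)))"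
    using wa z0a \<rho>(1) by (simp add: q_def ln_div algebra_simps)
  then have "Re (L w) - Re (L z0) - \<eta> * (norm (w - z0))\<^sup>2 = q z0 - q w"
    unfolding L0 Lw quad by (simp add: algebra_simps)
  moreover have "\<Psi> w \<le> \<Psi> z0" using w by (intro z0(2)) (auto simp: T_def K_def)
  ultimately show False
    using less fin by (cases "v z0"; cases "v w") (auto simp: \<Psi>_def)
qed

section \<open>Charts and entire curves\<close>

lemma chart_inj_on:
  assumes "complex_manifold M" "(U, \<phi>) \<in> charts M" shows "inj_on \<phi> U"
proof -
  have "homeomorphic_map (subtopology (mtop M) U) (top_of_set (\<phi> ` U)) \<phi>" "openin (mtop M) U"
    using assms unfolding complex_manifold_def by auto
  then show ?thesis
    using homeomorphic_imp_injective_map openin_subset by (metis topspace_subtopology_subset)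
qed

lemma chart_domain_open:
  assumes "complex_manifold M" "(U, \<phi>) \<in> charts M"
  shows "openin (mtop M) U" "open (\<phi> ` U)"
  using assms unfolding complex_manifold_def by auto

lemma chart_covers:
  assumes "complex_manifold M" "x \<in> topspace (mtop M)"
  obtains U \<phi> where "(U, \<phi>) \<in> charts M" "x \<in> U"
proof -
  have "x \<in> \<Union> (fst ` charts M)" using assms by (simp add: complex_manifold_def)
  then show thesis using that by auto
qed

lemma chart_homeomorphism:
  assumes "complex_manifold M" "(U, \<phi>) \<in> charts M"
  shows "continuous_map (subtopology (mtop M) U) euclidean \<phi>"
    and "continuous_map (top_of_set (\<phi> ` U)) (mtop M) (inv_into U \<phi>)"
    and "\<And>A. openin (mtop M) A \<Longrightarrow> A \<subseteq> U \<Longrightarrow> open (\<phi> ` A)"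
proof -
  have U: "openin (mtop M) U" "open (\<phi> ` U)" by (rule chart_domain_open[OF assms])+
  have top: "topspace (subtopology (mtop M) U) = U"
    using openin_subset[OF U(1)] by (simp add: Int_absorb1)
  have hom: "homeomorphic_map (subtopology (mtop M) U) (top_of_set (\<phi> ` U)) \<phi>"
    using assms unfolding complex_manifold_def by auto
  then have "continuous_map (subtopology (mtop M) U) (top_of_set (\<phi> ` U)) \<phi>"
    by (rule homeomorphic_imp_continuous_map)
  then show "continuous_map (subtopology (mtop M) U) euclidean \<phi>"
    by (rule continuous_map_into_fulltopology)
  obtain g where g: "homeomorphic_maps (subtopology (mtop M) U) (top_of_set (\<phi> ` U)) \<phi> g"
    using hom unfolding homeomorphic_map_maps by blast
  have "g z = inv_into U \<phi> z" if "z \<in> \<phi> ` U" for z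
    using that g chart_inj_on[OF assms] unfolding homeomorphic_maps_def top by auto
  moreover have "continuous_map (top_of_set (\<phi> ` U)) (subtopology (mtop M) U) g"
    using g unfolding homeomorphic_maps_def by blast
  ultimately have "continuous_map (top_of_set (\<phi> ` U)) (subtopology (mtop M) U) (inv_into U \<phi>)"
    by (auto intro: continuous_map_eq)
  then show "continuous_map (top_of_set (\<phi> ` U)) (mtop M) (inv_into U \<phi>)"
    by (rule continuous_map_into_fulltopology)
  show "open (\<phi> ` A)" if A: "openin (mtop M) A" "A \<subseteq> U" for A
  proof -
    have "openin (subtopology (mtop M) U) A"
      using A by (simp add: openin_open_subtopology U(1))
    then have "openin (top_of_set (\<phi> ` U)) (\<phi> ` A)"
      using homeomorphic_map_openness[OF hom, of A] A(2) top openin_subset[OF A(1)] by simp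
    then show ?thesis using U(2) openin_open_trans by blast
  qed
qed

definition entire_curve :: "('a, 'n::finite) mfd \<Rightarrow> (complex \<Rightarrow> 'a) \<Rightarrow> bool" where
  "entire_curve M h \<longleftrightarrow> continuous_map euclidean (mtop M) h \<and>
     (\<forall>(U, \<phi>) \<in> charts M. holo_curve_on (h -` U) (\<phi> \<circ> h))"

text \<open>Both conditions are local, and near a given parameter the curve stays in one chart.\<close>

lemma viscosity_subharmonic_entire_curve:
  assumes M: "complex_manifold M" and u: "plurisubharmonic M u" and h: "entire_curve M h"
  shows "viscosity_subharmonic (\<lambda>\<zeta>. u (h \<zeta>))"
proof -
  have hM: "h \<zeta> \<in> topspace (mtop M)" for \<zeta>
    using h continuous_map_image_subset_topspace unfolding entire_curve_def by fastforce
  have chart: "\<exists>U \<phi>. (U, \<phi>) \<in> charts M \<and> h \<zeta> \<in> U \<and> holo_curve_on (h -` U) (\<phi> \<circ> h)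
      \<and> psh_vec_on (\<phi> ` U) (u \<circ> inv_into U \<phi>)
      \<and> (\<forall>z\<in>h -` U. u (h z) = (u \<circ> inv_into U \<phi>) ((\<phi> \<circ> h) z))" for \<zeta>
  proof -
    obtain U \<phi> where U: "(U, \<phi>) \<in> charts M" "h \<zeta> \<in> U" using chart_covers[OF M hM] .
    have "holo_curve_on (h -` U) (\<phi> \<circ> h)"
      using h U(1) unfolding entire_curve_def by blast
    moreover have "psh_vec_on (\<phi> ` U) (u \<circ> inv_into U \<phi>)"
      using u U(1) unfolding plurisubharmonic_def by blast
    moreover have "\<forall>z\<in>h -` U. u (h z) = (u \<circ> inv_into U \<phi>) ((\<phi> \<circ> h) z)"
      using chart_inj_on[OF M U(1)] by simp
    ultimately show ?thesis using U by blast
  qed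
  show ?thesis
    unfolding viscosity_subharmonic_def
  proof (intro conjI allI impI)
    fix \<zeta>
    obtain U \<phi> where "(U, \<phi>) \<in> charts M" and U: "h \<zeta> \<in> U" "holo_curve_on (h -` U) (\<phi> \<circ> h)"
      "psh_vec_on (\<phi> ` U) (u \<circ> inv_into U \<phi>)"
      "\<forall>z\<in>h -` U. u (h z) = (u \<circ> inv_into U \<phi>) ((\<phi> \<circ> h) z)"
      using chart[of \<zeta>] by blast
    have op: "open (h -` U)" using U(2) by (simp add: holo_curve_on_def)
    have "isCont (\<phi> \<circ> h) \<zeta>" using holo_curve_on_isCont[OF U(2)] U(1) by simp
    moreover have "usc_at ((\<phi> \<circ> h) \<zeta>) (u \<circ> inv_into U \<phi>)"
      using U(1,3) by (intro usc_on_imp_usc_at[of "\<phi> ` U"]) (auto simp: psh_vec_on_def)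
    ultimately have "usc_at \<zeta> (\<lambda>z. (u \<circ> inv_into U \<phi>) ((\<phi> \<circ> h) z))"
      by (rule usc_at_compose)
    moreover have "\<forall>\<^sub>F z in nhds \<zeta>. z \<in> h -` U"
      using op U(1) by (intro eventually_nhds_in_open) auto
    ultimately show "usc_at \<zeta> (\<lambda>\<zeta>. u (h \<zeta>))"
      unfolding usc_at_def
    proof (intro allI impI)
      fix c
      assume lt: "\<forall>c>(u \<circ> inv_into U \<phi>) ((\<phi> \<circ> h) \<zeta>). \<forall>\<^sub>F z in nhds \<zeta>. (u \<circ> inv_into U \<phi>) ((\<phi> \<circ> h) z) < c"
        and ev: "\<forall>\<^sub>F z in nhds \<zeta>. z \<in> h -` U" and c: "u (h \<zeta>) < c"
      have "\<forall>\<^sub>F z in nhds \<zeta>. (u \<circ> inv_into U \<phi>) ((\<phi> \<circ> h) z) < c"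
        using lt c U(1,4) by simp
      with ev show "\<forall>\<^sub>F z in nhds \<zeta>. u (h z) < c"
        by eventually_elim (use U(4) in simp)
    qed
  next
    fix \<zeta>0 T L and c :: real
    assume T: "open T" "\<zeta>0 \<in> T" and L: "L holomorphic_on T" and c: "0 < c" and fin: "\<bar>u (h \<zeta>0)\<bar> \<noteq> \<infinity>"
    obtain U \<phi> where "(U, \<phi>) \<in> charts M" and U: "h \<zeta>0 \<in> U" "holo_curve_on (h -` U) (\<phi> \<circ> h)"
      "psh_vec_on (\<phi> ` U) (u \<circ> inv_into U \<phi>)"
      "\<forall>z\<in>h -` U. u (h z) = (u \<circ> inv_into U \<phi>) ((\<phi> \<circ> h) z)"
      using chart[of \<zeta>0] by blast
    show "\<exists>z\<in>T. u (h \<zeta>0) + ereal (Re (L z) - Re (L \<zeta>0) - c * (norm (z - \<zeta>0))\<^sup>2) < u (h z)"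
    proof (rule ccontr)
      assume contra: "\<not> ?thesis"
      show False
      proof (rule psh_no_strict_contact[OF U(3)])
        show "holo_curve_on (T \<inter> h -` U) (\<phi> \<circ> h)"
          using U(2) T(1) by (auto simp: holo_curve_on_def)
        show "L holomorphic_on T \<inter> h -` U" using L by (rule holomorphic_on_subset) simp
        show "\<bar>(u \<circ> inv_into U \<phi>) ((\<phi> \<circ> h) \<zeta>0)\<bar> \<noteq> \<infinity>" using fin U(1,4) by simp
        show "(u \<circ> inv_into U \<phi>) ((\<phi> \<circ> h) z) \<le> (u \<circ> inv_into U \<phi>) ((\<phi> \<circ> h) \<zeta>0)
            + ereal (Re (L z) - Re (L \<zeta>0) - c * (norm (z - \<zeta>0))\<^sup>2)" if "z \<in> T \<inter> h -` U" for z
          using contra that U(1,4) by (metis IntD1 IntD2 not_le vimageI)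
      qed (use T U c in auto)
    qed
  qed
qed

lemma holo_vec_on_compose_curve:
  assumes G: "holo_vec_on S G" and g: "(g has_derivative (\<lambda>\<tau>. \<tau> *s w)) (at \<zeta>)" and S: "g \<zeta> \<in> S"
    and N: "open N" "\<zeta> \<in> N" "\<And>z. z \<in> N \<Longrightarrow> k z = G (g z)"
  shows "\<exists>w'. (k has_derivative (\<lambda>\<tau>. \<tau> *s w')) (at \<zeta>)"
proof -
  obtain D where D: "(G has_derivative D) (at (g \<zeta>))" "\<And>c v. D (c *s v) = c *s D v"
    using G S unfolding holo_vec_on_def by blast
  have "((G \<circ> g) has_derivative (D \<circ> (\<lambda>\<tau>. \<tau> *s w))) (at \<zeta>)"
    using g D(1) by (rule diff_chain_at)
  then have "((\<lambda>z. G (g z)) has_derivative (\<lambda>\<tau>. \<tau> *s D w)) (at \<zeta>)"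
    by (simp add: o_def D(2))
  then have "(k has_derivative (\<lambda>\<tau>. \<tau> *s D w)) (at \<zeta>)"
    by (rule has_derivative_transform_within_open[OF _ N(1,2)]) (simp add: N(3))
  then show ?thesis ..
qed

section \<open>The complex plane as an open Riemann surface\<close>

definition complex_plane :: "(complex, 1) mfd" where
  "complex_plane = \<lparr>mtop = euclidean, charts = {(UNIV, vec)}\<rparr>"

lemma complex_plane_simps [simp]:
  "mtop complex_plane = euclidean" "charts complex_plane = {(UNIV, vec)}"
  by (simp_all add: complex_plane_def)

lemma bounded_linear_vec1: "bounded_linear (vec :: complex \<Rightarrow> complex ^ 1)"
  unfolding linear_conv_bounded_linear[symmetric] by (simp add: linear_iff vec_eq_iff)

lemma vec1_vec_nth: "vec (x $ 1) = (x :: complex ^ 1)"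
  by (simp add: vec_eq_iff forall_1)

lemma inv_vec1 [simp]: "inv_into UNIV (vec :: complex \<Rightarrow> complex ^ 1) = (\<lambda>x. x $ 1)"
proof
  fix x :: "complex ^ 1"
  show "inv_into UNIV vec x = x $ 1"
    by (metis UNIV_I f_inv_into_f rangeI vec1_vec_nth vec_component)
qed

lemma open_riemann_surface_complex_plane: "open_riemann_surface complex_plane"
proof -
  have surj: "range vec = (UNIV :: (complex ^ 1) set)"
    by (rule surjI[of _ "\<lambda>x. x $ 1"]) (rule vec1_vec_nth)
  have "homeomorphic_maps euclidean euclidean (vec :: complex \<Rightarrow> complex ^ 1) (\<lambda>x. x $ 1)"
    unfolding homeomorphic_maps_def
    by (auto simp: vec1_vec_nth linear_continuous_on bounded_linear_vec1 bounded_linear_vec_nth)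
  then have "homeomorphic_map euclidean euclidean (vec :: complex \<Rightarrow> complex ^ 1)"
    by (rule homeomorphic_maps_imp_map)
  moreover have "holo_vec_on UNIV (vec \<circ> (\<lambda>x. x $ 1) :: complex ^ 1 \<Rightarrow> complex ^ 1)"
    unfolding holo_vec_on_def
    by (auto simp: o_def vec1_vec_nth intro!: exI[of _ "\<lambda>x. x"])
  moreover have "second_countable (euclidean :: complex topology)"
  proof -
    obtain B :: "complex set set" where B: "countable B" "topological_basis B"
      using ex_countable_basis by blast
    then have "\<forall>V\<in>B. open V" "\<forall>U x. open U \<and> x \<in> U \<longrightarrow> (\<exists>V\<in>B. x \<in> V \<and> V \<subseteq> U)"
      by (simp add: topological_basis_open, meson topological_basisE)
    then show ?thesis using B(1) unfolding second_countable_def by auto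
  qed
  moreover have "connected_space (euclidean :: complex topology)"
    using connected_UNIV by (metis connectedin_iff_connected connectedin_topspace topspace_euclidean)
  moreover have "\<not> compact (UNIV :: complex set)" by simp
  ultimately show ?thesis
    unfolding open_riemann_surface_def complex_manifold_def
    by (auto simp: surj compact_space_def)
qed

lemma compact_runge_cball: "compact_runge (euclidean :: complex topology) (cball a r)"
  unfolding compact_runge_def
proof (intro conjI ballI notI)
  show "compactin euclidean (cball a r)" by simp
  fix C assume C: "C \<in> connected_components_of (top_of_set (topspace euclidean - cball a r))"
  have conn: "connected (- cball a r)"
    by (rule connected_complement_bounded_convex) auto
  then have "connected_space (top_of_set (- cball a r))"
    by (metis connectedin_def connectedin_iff_connected)
  then have "connected_components_of (top_of_set (- cball a r)) \<subseteq> {- cball a r}"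
    using connected_components_of_subset_sing[of "top_of_set (- cball a r)" "- cball a r"]
    by (metis topspace_euclidean_subtopology)
  then have "connected_components_of (top_of_set (topspace euclidean - cball a r)) \<subseteq> {- cball a r}"
    by (simp only: topspace_euclidean Compl_eq_Diff_UNIV)
  then have "C = - cball a r" using C by blast
  moreover assume "compactin euclidean (euclidean closure_of C)"
  ultimately have "bounded (- cball a r)"
    by (metis bounded_subset closure_subset compact_imp_bounded compactin_euclidean_iff euclidean_closure_of)
  then show False using cobounded_imp_unbounded[of "- cball a r"] by simp
qed

lemma discrete_sequence_of_nat: "discrete_sequence (euclidean :: complex topology) of_nat"
proof -
  have "x \<notin> euclidean derived_set_of range of_nat" for x :: complex
  proof -
    let ?T = "- (of_nat ` {n. of_nat n \<noteq> x}) :: complex set"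
    have "open ?T" by (intro open_Compl closed_of_nat_image)
    moreover have "x \<in> ?T" by auto
    moreover have "\<not> (\<exists>y. y \<noteq> x \<and> y \<in> range of_nat \<and> y \<in> ?T)" by auto
    ultimately show ?thesis unfolding in_derived_set_of by (metis open_openin)
  qed
  then show ?thesis by (auto simp: discrete_sequence_def inj_def)
qed

lemma holo_map_plane_imp_entire_curve:
  assumes M: "complex_manifold M" and F: "holo_map complex_plane M F"
  shows "entire_curve M F"
proof -
  have cont: "continuous_map euclidean (mtop M) F"
    using F by (simp add: holo_map_on_def)
  have "holo_curve_on (F -` U) (\<phi> \<circ> F)" if U: "(U, \<phi>) \<in> charts M" for U \<phi>
    unfolding holo_curve_on_def
  proof (intro conjI ballI)
    show "open (F -` U)"
      using openin_continuous_map_preimage[OF cont chart_domain_open(1)[OF M U]] by (simp add: vimage_def)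
    fix \<zeta> assume \<zeta>: "\<zeta> \<in> F -` U"
    have "holo_vec_on (vec ` (F -` U)) (\<phi> \<circ> F \<circ> (\<lambda>x :: complex ^ 1. x $ 1))"
      using F U by (auto simp: holo_map_on_def)
    moreover have "(vec :: complex \<Rightarrow> complex ^ 1) = (\<lambda>\<tau>. \<tau> *s vec 1)"
      by (auto simp: vec_eq_iff)
    then have "((vec :: complex \<Rightarrow> complex ^ 1) has_derivative (\<lambda>\<tau>. \<tau> *s vec 1)) (at \<zeta>)"
      using bounded_linear_imp_has_derivative[OF bounded_linear_vec1] by metis
    ultimately show "\<exists>w. ((\<phi> \<circ> F) has_derivative (\<lambda>\<tau>. \<tau> *s w)) (at \<zeta>)"
      by (rule holo_vec_on_compose_curve[where N = UNIV]) (use \<zeta> in auto)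
  qed
  then show ?thesis using cont by (auto simp: entire_curve_def)
qed

lemma holo_map_on_planeI:
  assumes W: "open W" and cont: "continuous_map (top_of_set W) (mtop M) f"
    and holo: "\<And>U \<phi> \<zeta>. (U, \<phi>) \<in> charts M \<Longrightarrow> \<zeta> \<in> W \<Longrightarrow> f \<zeta> \<in> U \<Longrightarrow>
                 \<exists>w. ((\<phi> \<circ> f) has_derivative (\<lambda>\<tau>. \<tau> *s w)) (at \<zeta>)"
  shows "holo_map_on complex_plane M W f"
proof -
  have "holo_vec_on (vec ` (W \<inter> f -` U)) (\<phi> \<circ> f \<circ> (\<lambda>x :: complex ^ 1. x $ 1))"
    if U: "(U, \<phi>) \<in> charts M" for U \<phi>
    unfolding holo_vec_on_def
  proof
    fix x :: "complex ^ 1" assume "x \<in> vec ` (W \<inter> f -` U)"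
    then obtain \<zeta> where \<zeta>: "\<zeta> \<in> W" "f \<zeta> \<in> U" "x = vec \<zeta>" by blast
    obtain w where w: "((\<phi> \<circ> f) has_derivative (\<lambda>\<tau>. \<tau> *s w)) (at \<zeta>)"
      using holo[OF U \<zeta>(1,2)] by blast
    have "((\<lambda>x :: complex ^ 1. x $ 1) has_derivative (\<lambda>x. x $ 1)) (at x)"
      by (rule bounded_linear_imp_has_derivative[OF bounded_linear_vec_nth])
    then have "(\<phi> \<circ> f \<circ> (\<lambda>x. x $ 1) has_derivative (\<lambda>\<tau>. \<tau> *s w) \<circ> (\<lambda>x. x $ 1)) (at x)"
      by (rule diff_chain_at) (simp add: \<zeta>(3) w)
    then show "\<exists>D. (\<phi> \<circ> f \<circ> (\<lambda>x. x $ 1) has_derivative D) (at x) \<and> (\<forall>c v. D (c *s v) = c *s D v)"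
      by (intro exI[of _ "(\<lambda>\<tau>. \<tau> *s w) \<circ> (\<lambda>x. x $ 1)"]) auto
  qed
  then show ?thesis using W cont by (auto simp: holo_map_on_def)
qed

section \<open>Lifting entire curves through holomorphic coverings\<close>

lemma biholo_on_imp_sheet:
  assumes "biholo_on Y X U V p"
  shows "sheet (mtop Y) (mtop X) p U V"
  using assms by (simp add: biholo_on_def holo_map_on_def sheet_def)

lemma holo_covering_evenly_covered:
  assumes "holo_covering Y p X" "x \<in> topspace (mtop X)"
  obtains V where "x \<in> V" "openin (mtop X) V"
    "\<And>y. y \<in> topspace (mtop Y) \<Longrightarrow> p y \<in> V \<Longrightarrow> \<exists>U. y \<in> U \<and> biholo_on Y X U V p"
proof -
  obtain V \<U> where V: "x \<in> V" "openin (mtop X) V"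
    and \<U>: "\<Union>\<U> = topspace (mtop Y) \<inter> p -` V" "\<forall>U\<in>\<U>. openin (mtop Y) U \<and> biholo_on Y X U V p"
    using assms unfolding holo_covering_def by meson
  show thesis
  proof (rule that[OF V])
    fix y assume "y \<in> topspace (mtop Y)" "p y \<in> V"
    then have "y \<in> \<Union>\<U>" using \<U>(1) by simp
    then show "\<exists>U. y \<in> U \<and> biholo_on Y X U V p" using \<U>(2) by blast
  qed
qed

lemma holo_covering_imp_topological_covering:
  assumes "holo_covering Y p X"
  shows "topological_covering (mtop Y) (mtop X) p"
  unfolding topological_covering_def
proof (intro conjI ballI)
  show "continuous_map (mtop Y) (mtop X) p"
    using assms unfolding holo_covering_def holo_map_on_def by (simp only: subtopology_topspace)
  fix x assume "x \<in> topspace (mtop X)"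
  then obtain V where V: "x \<in> V" "openin (mtop X) V"
    "\<And>y. y \<in> topspace (mtop Y) \<Longrightarrow> p y \<in> V \<Longrightarrow> \<exists>U. y \<in> U \<and> biholo_on Y X U V p"
    using holo_covering_evenly_covered[OF assms] by metis
  have "\<exists>U. y \<in> U \<and> sheet (mtop Y) (mtop X) p U V"
    if y: "y \<in> topspace (mtop Y)" "p y \<in> V" for y
  proof -
    obtain U where "y \<in> U" "biholo_on Y X U V p" using V(3)[OF y] by (elim exE conjE)
    then show ?thesis using biholo_on_imp_sheet by (intro exI[of _ U] conjI)
  qed
  with V(1,2) show "\<exists>V. x \<in> V \<and> openin (mtop X) V \<and>
      (\<forall>y\<in>topspace (mtop Y). p y \<in> V \<longrightarrow> (\<exists>U. y \<in> U \<and> sheet (mtop Y) (mtop X) p U V))"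
    by (intro exI[of _ V] conjI ballI impI)
qed

text \<open>Locally the lift is the curve in the base followed by the inverse of the projection on one sheet.\<close>

lemma entire_curve_lift:
  assumes X: "complex_manifold X" and Y: "complex_manifold Y" and cov: "holo_covering Y p X"
    and F: "entire_curve X F"
    and h: "continuous_map euclidean (mtop Y) h" "\<And>z. p (h z) = F z"
  shows "entire_curve Y h"
proof -
  have hY: "h z \<in> topspace (mtop Y)" for z
    using h(1) continuous_map_image_subset_topspace by fastforce
  have FX: "F z \<in> topspace (mtop X)" for z
    using F continuous_map_image_subset_topspace unfolding entire_curve_def by fastforce
  have opF: "open (F -` V)" if "openin (mtop X) V" for V
    using openin_continuous_map_preimage[OF _ that, of euclidean F] F
    by (simp add: vimage_def entire_curve_def)
  have oph: "open (h -` U)" if "openin (mtop Y) U" for U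
    using openin_continuous_map_preimage[OF h(1) that] by (simp add: vimage_def)
  have "\<exists>w. (\<phi> \<circ> h has_derivative (\<lambda>\<tau>. \<tau> *s w)) (at \<zeta>)"
    if U: "(U, \<phi>) \<in> charts Y" and \<zeta>: "h \<zeta> \<in> U" for U \<phi> \<zeta>
  proof -
    obtain V where V: "F \<zeta> \<in> V" "openin (mtop X) V"
      "\<And>y. y \<in> topspace (mtop Y) \<Longrightarrow> p y \<in> V \<Longrightarrow> \<exists>U. y \<in> U \<and> biholo_on Y X U V p"
      using holo_covering_evenly_covered[OF cov FX[of \<zeta>]] by metis
    obtain S where S: "h \<zeta> \<in> S" "biholo_on Y X S V p" using V(1,3) hY h(2) by metis
    have inj: "inj_on p S" using S(2) by (auto simp: biholo_on_def bij_betw_def)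
    have opS: "openin (mtop Y) S" using S(2) by (simp add: biholo_on_def holo_map_on_def)
    define q where "q = inv_into S p"
    have q: "holo_map_on X Y V q" using S(2) by (simp add: biholo_on_def q_def)
    have hq: "q (F z) = h z" if "h z \<in> S" for z
      using inv_into_f_f[OF inj that] by (simp add: q_def h(2))
    obtain C \<psi> where C: "(C, \<psi>) \<in> charts X" "F \<zeta> \<in> C" using chart_covers[OF X FX[of \<zeta>]] .
    have "holo_vec_on (\<psi> ` (C \<inter> V \<inter> q -` U)) (\<phi> \<circ> q \<circ> inv_into C \<psi>)"
      using q C U unfolding holo_map_on_def by blast
    moreover obtain w where "(\<psi> \<circ> F has_derivative (\<lambda>\<tau>. \<tau> *s w)) (at \<zeta>)"
      using F C unfolding entire_curve_def holo_curve_on_def by blast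
    ultimately show ?thesis
    proof (rule holo_vec_on_compose_curve[where N = "F -` C \<inter> h -` S"])
      show "(\<psi> \<circ> F) \<zeta> \<in> \<psi> ` (C \<inter> V \<inter> q -` U)"
        using C V \<zeta> hq[OF S(1)] by auto
      show "open (F -` C \<inter> h -` S)"
        using opF[OF chart_domain_open(1)[OF X C(1)]] oph[OF opS] by blast
      show "(\<phi> \<circ> h) z = (\<phi> \<circ> q \<circ> inv_into C \<psi>) ((\<psi> \<circ> F) z)" if "z \<in> F -` C \<inter> h -` S" for z
        using that hq chart_inj_on[OF X C(1)] by simp
    qed (use C S in auto)
  qed
  then show ?thesis
    using h(1) oph chart_domain_open(1)[OF Y] by (auto simp: entire_curve_def holo_curve_on_def)
qed

section \<open>Entire curves through two nearby points\<close>

lemma norm_vec_smult: "norm (c *s x) = norm c * norm (x :: complex ^ 'n::finite)"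
  by (simp add: norm_vec_def norm_mult L2_set_right_distrib)

lemma bounded_linear_smult_vec: "bounded_linear (\<lambda>\<tau>. \<tau> *s (w :: complex ^ 'n::finite))"
proof
  show "\<exists>K. \<forall>x. norm (x *s w) \<le> norm x * K" by (auto simp: norm_vec_smult)
qed (simp_all add: vec_eq_iff algebra_simps)

text \<open>The identity near the closed unit disc and zero far out. The transition annulus
  \<open>3/2 \<le> |z| \<le> 7/4\<close> is placed between the integers 1 and 2, so that the function is
  holomorphic near every integer.\<close>

definition cutoff :: "complex \<Rightarrow> complex" where
  "cutoff z = of_real (max 0 (min 1 (7 - 4 * norm z))) * z"

lemma cutoff_eq_self: "norm z \<le> 3 / 2 \<Longrightarrow> cutoff z = z"
  by (simp add: cutoff_def)

lemma cutoff_eq_0: "7 / 4 \<le> norm z \<Longrightarrow> cutoff z = 0"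
  by (simp add: cutoff_def)

lemma norm_cutoff: "norm (cutoff z) < 2"
proof (cases "norm z < 7 / 4")
  case True
  have "norm (cutoff z) = max 0 (min 1 (7 - 4 * norm z)) * norm z"
    by (simp add: cutoff_def norm_mult)
  also have "\<dots> \<le> 1 * norm z" by (intro mult_right_mono) auto
  finally show ?thesis using True by simp
qed (simp add: cutoff_eq_0)

lemma continuous_on_cutoff: "continuous_on S cutoff"
  unfolding cutoff_def by (intro continuous_intros)

lemma affine_cutoff_has_complex_derivative: 
  assumes "norm \<zeta> < 3 / 2 \<or> 7 / 4 < norm \<zeta>"
  shows "\<exists>w'. ((\<lambda>z. b + cutoff z *s w) has_derivative (\<lambda>\<tau>. \<tau> *s w')) (at \<zeta>)"
proof (cases "norm \<zeta> < 3 / 2")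
  case True
  have "((\<lambda>z. b + z *s w) has_derivative (\<lambda>\<tau>. 0 + \<tau> *s w)) (at \<zeta>)"
    by (intro has_derivative_add has_derivative_const bounded_linear_imp_has_derivative bounded_linear_smult_vec)
  then have "((\<lambda>z. b + cutoff z *s w) has_derivative (\<lambda>\<tau>. 0 + \<tau> *s w)) (at \<zeta>)"
    by (rule has_derivative_transform_within_open[where s = "ball 0 (3 / 2)"])
      (use True in \<open>auto simp: cutoff_eq_self\<close>)
  then show ?thesis by auto
next
  case False
  have "((\<lambda>z. b) has_derivative (\<lambda>\<tau>. \<tau> *s 0)) (at \<zeta>)"
    by simp
  then have "((\<lambda>z. b + cutoff z *s w) has_derivative (\<lambda>\<tau>. \<tau> *s 0)) (at \<zeta>)"
    by (rule has_derivative_transform_within_open[where s = "- cball 0 (7 / 4)"])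
      (use False assms in \<open>auto simp: cutoff_eq_0\<close>)
  then show ?thesis by blast
qed

section \<open>Oka-1 manifolds are strongly Liouville\<close>

lemma locally_constant_imp_constant:
  assumes M: "connected_space T" 
    and loc: "\<And>y. y \<in> topspace T \<Longrightarrow> \<exists>N. openin T N \<and> y \<in> N \<and> (\<forall>z\<in>N. f z = f y)"
  shows "\<exists>c. \<forall>y\<in>topspace T. f y = c"
proof (cases "topspace T = {}")
  case False
  then obtain y0 where y0: "y0 \<in> topspace T" by blast
  let ?A = "{y \<in> topspace T. f y = f y0}"
  have op: "openin T {y \<in> topspace T. f y \<in> B}" for B
  proof (subst openin_subopen, intro ballI)
    fix y assume y: "y \<in> {y \<in> topspace T. f y \<in> B}"
    then obtain N where N: "openin T N" "y \<in> N" "\<forall>z\<in>N. f z = f y" using loc by blast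
    have "z \<in> {y \<in> topspace T. f y \<in> B}" if "z \<in> N" for z
    proof -
      have "f z = f y" using N(3) that by blast
      then show ?thesis using y openin_subset[OF N(1)] that by auto
    qed
    then show "\<exists>N. openin T N \<and> y \<in> N \<and> N \<subseteq> {y \<in> topspace T. f y \<in> B}" using N by blast
  qed
  have "openin T ?A" using op[of "{f y0}"] by simp
  moreover have "topspace T - ?A = {y \<in> topspace T. f y \<in> - {f y0}}" by auto
  then have "openin T (topspace T - ?A)" using op[of "- {f y0}"] by simp
  ultimately have "?A = {} \<or> ?A = topspace T"
    using M unfolding connected_space_clopen_in closedin_def by blast
  then show ?thesis using y0 by blast
qed auto

text \<open>The Oka-1 property is applied to the plane, the closed unit disc as Runge set, the sequence
  \<open>0, 1, 2, \<dots>\<close>, and a map \<open>f\<close> that is an affine disc inside the chart near the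
  unit disc and is squeezed to the centre \<open>b\<close> far out. Interpolation at 0 and 1 gives the two
  points, and approximation keeps the image of the unit disc close to the image of the coordinate
  ball. The latter determines, later on, to which sheet of a covering the lift of the unit disc
  belongs; the homotopy class of the curve gives no such control because the homotopy moves the
  points.\<close>

lemma oka1_entire_curve_through_two_points:
  fixes X :: "('a, 'n::finite) mfd"
  assumes oka: "oka1_manifold X d" and C: "(C, \<psi>) \<in> charts X"
    and b: "ball b (2 * \<delta>) \<subseteq> \<psi> ` C" and w: "norm w < \<delta>" and \<epsilon>: "0 < \<epsilon>"
  obtains F where "entire_curve X F" "F 0 = inv_into C \<psi> b" "F 1 = inv_into C \<psi> (b + w)"
    "\<And>z. norm z \<le> 1 \<Longrightarrow> \<exists>x\<in>inv_into C \<psi> ` ball b (2 * \<delta>). d (F z) x < \<epsilon>"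
proof -
  have X: "complex_manifold X" using oka by (simp add: oka1_manifold_def)
  define g where "g z = b + cutoff z *s w" for z
  define f where "f = inv_into C \<psi> \<circ> g"
  define W where "W = ball 0 (3 / 2) \<union> - cball (0::complex) (7 / 4)"
  have g_ball: "g z \<in> ball b (2 * \<delta>)" for z
  proof -
    have "norm (cutoff z *s w) \<le> 2 * norm w"
      unfolding norm_vec_smult using norm_cutoff[of z] by (intro mult_right_mono) auto
    then show ?thesis using w by (simp add: g_def dist_norm)
  qed
  have g_cont: "continuous_map euclidean (top_of_set (\<psi> ` C)) g"
  proof -
    have "continuous_on UNIV g"
      unfolding g_def
      by (intro continuous_intros bounded_linear.continuous_on[OF bounded_linear_smult_vec] continuous_on_cutoff)
    then show ?thesis using g_ball b by (auto simp: continuous_map_in_subtopology)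
  qed
  have f_cont: "continuous_map euclidean (mtop X) f"
    unfolding f_def by (rule continuous_map_compose[OF g_cont chart_homeomorphism(2)[OF X C]])
  have inj: "inj_on \<psi> C" by (rule chart_inj_on[OF X C])
  have f_holo: "holo_map_on complex_plane X W f"
  proof (rule holo_map_on_planeI)
    show "open W" by (auto simp: W_def)
    show "continuous_map (top_of_set W) (mtop X) f"
      by (rule continuous_map_from_subtopology[OF f_cont])
    fix U \<phi> \<zeta> assume U: "(U, \<phi>) \<in> charts X" and \<zeta>: "\<zeta> \<in> W" "f \<zeta> \<in> U"
    have "holo_vec_on (\<psi> ` (C \<inter> U)) (\<phi> \<circ> inv_into C \<psi>)"
      using X C U unfolding complex_manifold_def by blast
    moreover have "norm \<zeta> < 3 / 2 \<or> 7 / 4 < norm \<zeta>" using \<zeta>(1) by (auto simp: W_def)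
    then obtain w' where "(g has_derivative (\<lambda>\<tau>. \<tau> *s w')) (at \<zeta>)"
      unfolding g_def using affine_cutoff_has_complex_derivative by blast
    ultimately show "\<exists>w. ((\<phi> \<circ> f) has_derivative (\<lambda>\<tau>. \<tau> *s w)) (at \<zeta>)"
    proof (rule holo_vec_on_compose_curve[where N = UNIV])
      obtain x where x: "x \<in> C" "g \<zeta> = \<psi> x" using g_ball b by blast
      then have "f \<zeta> = x" using inj by (simp add: f_def)
      then show "g \<zeta> \<in> \<psi> ` (C \<inter> U)" using x \<zeta>(2) by auto
    qed (auto simp: f_def)
  qed
  have KW: "cball 0 1 \<union> range of_nat \<subseteq> W"
  proof -
    have "of_nat n \<in> W" for n
    proof (cases "n \<le> 1")
      case False
      then have "real n \<ge> 2" by simp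
      then show ?thesis by (simp add: W_def)
    qed (auto simp: W_def le_Suc_eq)
    moreover have "cball 0 1 \<subseteq> W" by (auto simp: W_def)
    ultimately show ?thesis by blast
  qed
  obtain F where F: "holo_map complex_plane X F"
    and app: "(SUP z\<in>cball 0 1. ereal (d (F z) (f z))) < ereal \<epsilon>"
    and ord: "\<And>i. agree_to_order complex_plane X 1 (of_nat i) F f"
  proof -
    have "\<exists>F. holo_map complex_plane X F \<and>
             homotopic_with (\<lambda>_. True) (mtop complex_plane) (mtop X) f F \<and>
             (SUP p\<in>cball 0 1. ereal (d (F p) (f p))) < ereal \<epsilon> \<and>
             (\<forall>i. agree_to_order complex_plane X ((\<lambda>_. 1) i) (of_nat i) F f)"
    proof (rule oka[unfolded oka1_manifold_def, THEN conjunct2, THEN conjunct2, THEN conjunct2, rule_format])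
      show "open_riemann_surface complex_plane" by (rule open_riemann_surface_complex_plane)
      show "compact_runge (mtop complex_plane) (cball 0 1)" by (simp add: compact_runge_cball)
      show "discrete_sequence (mtop complex_plane) of_nat" by (simp add: discrete_sequence_of_nat)
      show "continuous_map (mtop complex_plane) (mtop X) f" using f_cont by simp
      show "openin (mtop complex_plane) W" by (auto simp: W_def)
      show "cball 0 1 \<union> range of_nat \<subseteq> W" by (rule KW)
      show "holo_map_on complex_plane X W f" by (rule f_holo)
    qed (use \<epsilon> in auto)
    then show thesis using that by auto
  qed
  have Ff: "F (of_nat i) = f (of_nat i)" for i
    using ord[of i] by (simp add: agree_to_order_def)
  show thesis
  proof (rule that)
    show "entire_curve X F" by (rule holo_map_plane_imp_entire_curve[OF X F])
    show "F 0 = inv_into C \<psi> b" using Ff[of 0] by (simp add: f_def g_def cutoff_def)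
    show "F 1 = inv_into C \<psi> (b + w)" using Ff[of 1] by (simp add: f_def g_def cutoff_eq_self)
    show "\<exists>x\<in>inv_into C \<psi> ` ball b (2 * \<delta>). d (F z) x < \<epsilon>" if "norm z \<le> 1" for z
    proof -
      have "ereal (d (F z) (f z)) \<le> (SUP z\<in>cball 0 1. ereal (d (F z) (f z)))"
        using that by (intro SUP_upper) auto
      then have "d (F z) (f z) < \<epsilon>" using app by (metis ereal_less_eq(3) less_ereal.simps(1) order_le_less_trans)
      then show ?thesis using g_ball[of z] by (auto simp: f_def)
    qed
  qed
qed

theorem corollary7p5:
  fixes X :: "('a, 'n::finite) mfd" and d :: "'a \<Rightarrow> 'a \<Rightarrow> real"
  assumes "oka1_manifold X d"
  shows "strongly_liouville TYPE('b) X"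
  unfolding strongly_liouville_def liouville_def
proof (intro allI impI, elim conjE)
  fix Y :: "('b, 'n) mfd" and p u
  assume "universal_covering Y p X" and u: "plurisubharmonic Y u"
    and neg: "\<forall>y\<in>topspace (mtop Y). u y < 0"
  then have Y: "complex_manifold Y" and cov: "holo_covering Y p X"
    by (auto simp: universal_covering_def)
  have X: "complex_manifold X" and met: "Metric_space (topspace (mtop X)) d"
    and top: "Metric_space.mtopology (topspace (mtop X)) d = mtop X"
    using assms by (auto simp: oka1_manifold_def)
  interpret Metric_space "topspace (mtop X)" d by (rule met)
  have tcov: "topological_covering (mtop Y) (mtop X) p"
    by (rule holo_covering_imp_topological_covering[OF cov])
  have p: "continuous_map (mtop Y) (mtop X) p" using tcov by (simp add: topological_covering_def)
  have Haus: "Hausdorff_space (mtop Y)" and conn: "connected_space (mtop Y)"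
    using Y by (auto simp: complex_manifold_def)
  show "\<exists>c. \<forall>y\<in>topspace (mtop Y). u y = c"
  proof (rule locally_constant_imp_constant[OF conn])
    fix y0 assume y0: "y0 \<in> topspace (mtop Y)"
    then have x0: "p y0 \<in> topspace (mtop X)" using p continuous_map_image_subset_topspace by fastforce
    obtain V where V: "p y0 \<in> V" "openin (mtop X) V"
      "\<And>y. y \<in> topspace (mtop Y) \<Longrightarrow> p y \<in> V \<Longrightarrow> \<exists>U. y \<in> U \<and> sheet (mtop Y) (mtop X) p U V"
      using topological_coveringE[OF tcov x0] by metis
    obtain U0 where U0: "y0 \<in> U0" "sheet (mtop Y) (mtop X) p U0 V" using V(1,3) y0 by blast
    obtain C \<psi> where C: "(C, \<psi>) \<in> charts X" "p y0 \<in> C" using chart_covers[OF X x0] .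
    have inj: "inj_on \<psi> C" by (rule chart_inj_on[OF X C(1)])
    have "openin mtopology V" using V(2) by (simp only: top)
    then obtain e where e: "e > 0" "mball (p y0) e \<subseteq> V"
      using V(1) unfolding openin_mtopology by blast
    \<comment> \<open>Radius \<open>e/2\<close>, since approximation up to \<open>e/2\<close> then leads to points of
        \<open>V\<close>.\<close>
    define A where "A = C \<inter> mball (p y0) (e / 2)"
    define b where "b = \<psi> (p y0)"
    have "openin (mtop X) A"
      unfolding A_def using chart_domain_open(1)[OF X C(1)] openin_mball[of "p y0" "e / 2"]
      by (simp add: top openin_Int)
    then have "open (\<psi> ` A)" using chart_homeomorphism(3)[OF X C(1)] by (simp add: A_def)
    moreover have "b \<in> \<psi> ` A" using C(2) e(1) x0 by (auto simp: A_def b_def)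
    ultimately obtain r where r: "r > 0" "ball b r \<subseteq> \<psi> ` A" by (meson open_contains_ball)
    define \<delta> where "\<delta> = r / 2"
    have \<delta>: "\<delta> > 0" "ball b (2 * \<delta>) \<subseteq> \<psi> ` A" using r by (auto simp: \<delta>_def)
    define N where "N = {x \<in> C. \<psi> x \<in> ball b \<delta>}"
    have N: "openin (mtop X) N"
    proof -
      have "openin (subtopology (mtop X) C) {x \<in> topspace (subtopology (mtop X) C). \<psi> x \<in> ball b \<delta>}"
        by (rule openin_continuous_map_preimage[OF chart_homeomorphism(1)[OF X C(1)]]) simp
      moreover have "topspace (subtopology (mtop X) C) = C"
        using openin_subset[OF chart_domain_open(1)[OF X C(1)]] by auto
      ultimately show ?thesis
        unfolding N_def using openin_trans_full chart_domain_open(1)[OF X C(1)] by metis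
    qed
    \<comment> \<open>The neighbourhood of \<open>y0\<close> on which \<open>u\<close> is shown to be constant.\<close>
    define P where "P = U0 \<inter> {y \<in> topspace (mtop Y). p y \<in> N}"
    have "openin (mtop Y) P"
      unfolding P_def using U0(2) openin_continuous_map_preimage[OF p N]
      by (auto simp: sheet_def)
    moreover have "y0 \<in> P" using U0(1) y0 C(2) \<delta>(1) by (simp add: P_def N_def b_def)
    moreover have "u y1 = u y0" if y1: "y1 \<in> P" for y1
    proof -
      define w where "w = \<psi> (p y1) - b"
      have py1: "p y1 \<in> C" and w: "norm w < \<delta>"
        using y1 by (auto simp: P_def N_def w_def dist_norm norm_minus_commute)
      have "ball b (2 * \<delta>) \<subseteq> \<psi> ` C" using \<delta>(2) by (auto simp: A_def)
      then obtain F where F: "entire_curve X F" "F 0 = inv_into C \<psi> b" "F 1 = inv_into C \<psi> (b + w)"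
        "\<And>z. norm z \<le> 1 \<Longrightarrow> \<exists>x\<in>inv_into C \<psi> ` ball b (2 * \<delta>). d (F z) x < e / 2"
        using oka1_entire_curve_through_two_points[OF assms C(1) _ w half_gt_zero[OF e(1)]] by metis
      have F0: "F 0 = p y0" using F(2) inj C(2) by (simp add: b_def)
      have F1: "F 1 = p y1" using F(3) inj py1 by (simp add: w_def)
      have F_cont: "continuous_map euclidean (mtop X) F" using F(1) by (simp add: entire_curve_def)
      have F_V: "F z \<in> V" if z: "norm z \<le> 1" for z
      proof -
        obtain v where v: "v \<in> ball b (2 * \<delta>)" "d (F z) (inv_into C \<psi> v) < e / 2"
          using F(4)[OF z] by blast
        obtain x where x: "x \<in> A" "v = \<psi> x" using v(1) \<delta>(2) by blast
        have "inv_into C \<psi> v = x" using x inj by (simp add: A_def)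
        moreover have "F z \<in> topspace (mtop X)"
          using F_cont continuous_map_image_subset_topspace by fastforce
        moreover have "x \<in> topspace (mtop X)" "d (p y0) x < e / 2" using x by (auto simp: A_def)
        ultimately have "d (p y0) (F z) < e"
          using v(2) triangle[of "p y0" x "F z"] x0 commute[of x "F z"] by simp
        then show ?thesis using e(2) x0 \<open>F z \<in> topspace (mtop X)\<close> by auto
      qed
      obtain h where h: "continuous_map euclidean (mtop Y) h" "\<And>z. p (h z) = F z" "h 0 = y0"
        using lift_exists_plane[OF Haus tcov F_cont y0] F0 by metis
      have F_ball: "continuous_map (top_of_set (cball 0 1)) (mtop X) F"
        by (rule continuous_map_from_subtopology[OF F_cont])
      have F_img: "F ` topspace (top_of_set (cball 0 1)) \<subseteq> V" using F_V by auto
      note lift = lift_into_sheet[OF U0(2) F_ball F_img]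
      have inj_p: "inj_on p U0" using U0(2) by (auto simp: sheet_def bij_betw_def)
      \<comment> \<open>The unit disc is mapped into \<open>V\<close>, so its lift cannot leave the sheet \<open>U0\<close>.\<close>
      have "h 1 = (inv_into U0 p \<circ> F) 1"
      proof (rule lift_unique[OF Haus tcov, where Z = "top_of_set (cball 0 1)" and ?z0.0 = 0])
        show "connected_space (top_of_set (cball (0::complex) 1))"
          by (metis connected_cball connectedin_def connectedin_iff_connected)
        show "continuous_map (top_of_set (cball 0 1)) (mtop Y) h"
          by (rule continuous_map_from_subtopology[OF h(1)])
        show "continuous_map (top_of_set (cball 0 1)) (mtop Y) (inv_into U0 p \<circ> F)"
          by (rule lift(1))
        show "p (h z) = p ((inv_into U0 p \<circ> F) z)" if "z \<in> topspace (top_of_set (cball 0 1))" for z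
          using lift(2)[OF that] h(2) by simp
        show "h 0 = (inv_into U0 p \<circ> F) 0"
          using h(3) F0 inv_into_f_f[OF inj_p U0(1)] by simp
      qed auto
      then have h1: "h 1 = y1"
        using F1 inv_into_f_f[OF inj_p, of y1] y1 by (simp add: P_def)
      have "viscosity_subharmonic (\<lambda>z. u (h z))"
        by (rule viscosity_subharmonic_entire_curve[OF Y u entire_curve_lift[OF X Y cov F(1) h(1,2)]])
      moreover have "u (h z) < 0" for z
        using neg h(1) continuous_map_image_subset_topspace by fastforce
      ultimately have "u (h 1) \<le> u (h 0)" "u (h 0) \<le> u (h 1)"
        using viscosity_subharmonic_negative_imp_le[of "\<lambda>z. u (h z)"] by blast+
      then show ?thesis using h(3) h1 by simp
    qed
    ultimately show "\<exists>N. openin (mtop Y) N \<and> y0 \<in> N \<and> (\<forall>z\<in>N. u z = u y0)" by blast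
  qed
qed

end
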